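(* Let $g=\begin{pmatrix}a&b\\ \bar b&\bar a\end{pmatrix}\in\mathrm{SU}(1,1)$ ($a,b\in\mathbb{C}$, $|a|^2-|b|^2=1$), $\alpha,z\in\mathbb{C}$, $w\in\mathbb{C}$ with $|w|<1$. Then $$S(g)D(\alpha)e_{z,w}=\lambda\, e_{z_1,w_1},\qquad \lambda=\lambda(g,\alpha;z,w),$$ where $$z_1=\frac{\alpha-\bar\alpha w+z}{\bar bw+\bar a},\qquad w_1=g\cdot w=\frac{aw+b}{\bar bw+\bar a},$$ $$\lambda=(\bar a+\bar bw)^{-2k}\exp\Big(\frac z2\bar\alpha_0-\frac{z_1}{2}\bar\alpha_2\Big)\exp\big(i\theta_h(\alpha_1,\alpha_0)\big),$$ $$\alpha_0=\frac{z+\bar zw}{1-w\bar w},\qquad \alpha_1=\alpha+\alpha_0,\qquad \alpha_2=(\alpha+\alpha_0)a+(\bar\alpha+\bar\alpha_0)b,$$ and $\theta_h(\beta,\gamma):=\operatorname{Im}(\beta\bar\gamma)$ for $\beta,\gamma\in\mathbb{C}$.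
   Context: (In the claim the letters $a,b$ denote matrix entries of $g$; below $a,a^+$ also denote the annihilation/creation operators.) The Jacobi algebra is $\mathfrak{g}^J_1=\mathfrak{h}_1\rtimes\mathfrak{su}(1,1)$, where $\mathfrak{h}_1=\{is1+xa^+-\bar xa: s\in\mathbb{R},x\in\mathbb{C}\}$ is an ideal and $\mathfrak{su}(1,1)=\{2i\theta K_0+yK_+-\bar yK_-:\theta\in\mathbb{R},y\in\mathbb{C}\}$, with commutation relations ($1$ central) $[a,a^+]=1$; $[K_0,K_\pm]=\pm K_\pm$; $[K_-,K_+]=2K_0$; $[a,K_+]=a^+$; $[K_-,a^+]=a$; $[K_+,a^+]=[K_-,a]=0$; $[K_0,a^+]=\frac12a^+$; $[K_0,a]=-\frac12a$. One is given a continuous unitary representation of the Jacobi group $G^J_1=H_1\rtimes \mathrm{SU}(1,1)$ ($H_1$ the 3-dimensional Heisenberg-Weyl group) on a separable complex Hilbert space $\mathcal{H}$. Its derived representation, extended complex linearly, represents $a,a^+,K_0,K_\pm$ by operators (written $a,a^+,\boldsymbol{K}_0,\boldsymbol{K}_\pm$) on the dense space $\mathcal{H}^\infty$ of smooth vectors, satisfying the commutation relations above with $1$ acting as the identity, and with formal adjoints $(a^+)^+=a$, $\boldsymbol{K}_0^+=\boldsymbol{K}_0$, $\boldsymbol{K}_\pm^+=\boldsymbol{K}_\mp$. There is a cyclic vector $e_0\in\mathcal{H}^\infty$ with $ae_0=0$, $\boldsymbol{K}_-e_0=0$, $\boldsymbol{K}_0e_0=ke_0$, where $k>0$, $2k\in\{2,3,\dots\}$.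 Perelomov's coherent state vectors are $e_{z,w}:=e^{za^++w\boldsymbol{K}_+}e_0$ (exponential power series applied to $e_0$), $z\in\mathbb{C}$, $|w|<1$. $D(\alpha):=\exp(\alpha a^+-\bar\alpha a)$ is the displacement operator. $S$ denotes the restriction of the representation to $\mathrm{SU}(1,1)$, with the identification that for $X=\begin{pmatrix}i\theta&\zeta\\ \bar\zeta&-i\theta\end{pmatrix}$ ($\theta\in\mathbb{R}$, $\zeta\in\mathbb{C}$) one has $S(e^X)=\exp(2i\theta\boldsymbol{K}_0+\zeta\boldsymbol{K}_+-\bar\zeta\boldsymbol{K}_-)$. *)

theory Defs
  imports "HOL-Analysis.Analysis"
begin

section \<open>Complex Hilbert spaces\<close>

text \<open>A complex inner product space over the real structure of \<open>real_inner\<close>; the inner product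
  is conjugate linear in its first argument. A separable complex Hilbert space is a type of sort
  \<open>{complex_inner, polish_space}\<close>.\<close>

class complex_inner = real_inner +
  fixes scaleC :: "complex \<Rightarrow> 'a \<Rightarrow> 'a" (infixr "*\<^sub>C" 75)
    and cinner :: "'a \<Rightarrow> 'a \<Rightarrow> complex"
  assumes scaleC_add_right: "c *\<^sub>C (x + y) = c *\<^sub>C x + c *\<^sub>C y"
    and scaleC_add_left: "(c + d) *\<^sub>C x = c *\<^sub>C x + d *\<^sub>C x"
    and scaleC_scaleC: "c *\<^sub>C d *\<^sub>C x = (c * d) *\<^sub>C x"
    and scaleC_of_real: "complex_of_real r *\<^sub>C x = r *\<^sub>R x"
    and cinner_commute: "cinner x y = cnj (cinner y x)"
    and cinner_add_right: "cinner x (y + z) = cinner x y + cinner x z"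
    and cinner_scaleC_right: "cinner x (c *\<^sub>C y) = c * cinner x y"
    and Re_cinner: "Re (cinner x y) = inner x y"

definition unitary_op :: "('h::complex_inner \<Rightarrow> 'h) \<Rightarrow> bool" where
  "unitary_op U \<longleftrightarrow>
     (\<forall>x y. U (x + y) = U x + U y) \<and> (\<forall>c x. U (c *\<^sub>C x) = c *\<^sub>C U x) \<and>
     (\<forall>x y. cinner (U x) (U y) = cinner x y) \<and> surj U"

definition linear_endo_on :: "'h::complex_inner set \<Rightarrow> ('h \<Rightarrow> 'h) \<Rightarrow> bool" where
  "linear_endo_on V A \<longleftrightarrow>
     (\<forall>v\<in>V. A v \<in> V) \<and> (\<forall>u\<in>V. \<forall>v\<in>V. A (u + v) = A u + A v) \<and>
     (\<forall>c. \<forall>v\<in>V. A (c *\<^sub>C v) = c *\<^sub>C A v)"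

definition formal_adjoint_on ::
  "'h::complex_inner set \<Rightarrow> ('h \<Rightarrow> 'h) \<Rightarrow> ('h \<Rightarrow> 'h) \<Rightarrow> bool" where
  "formal_adjoint_on V A B \<longleftrightarrow> (\<forall>u\<in>V. \<forall>v\<in>V. cinner (A u) v = cinner u (B v))"

definition unitary_group :: "(real \<Rightarrow> 'h::complex_inner \<Rightarrow> 'h) \<Rightarrow> bool" where
  "unitary_group U \<longleftrightarrow>
     (\<forall>t. unitary_op (U t)) \<and> (\<forall>s t. U (s + t) = U s \<circ> U t) \<and>
     (\<forall>v. continuous_on UNIV (\<lambda>t. U t v))"

text \<open>The exponential of an unbounded operator \<open>A\<close> that is essentially skew-adjoint on the dense
  domain \<open>V\<close>: by Stone's theorem there is then exactly one strongly continuous unitary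
  one-parameter group whose generator extends \<open>A\<close>, and the exponential is its value at time 1.\<close>

definition op_exp :: "'h::complex_inner set \<Rightarrow> ('h \<Rightarrow> 'h) \<Rightarrow> 'h \<Rightarrow> 'h" where
  "op_exp V A = (THE T. \<exists>U. unitary_group U \<and>
     (\<forall>v\<in>V. ((\<lambda>t. U t v) has_vector_derivative A v) (at 0)) \<and> T = U 1)"


section \<open>Smooth maps\<close>

primrec C_k_on ::
  "nat \<Rightarrow> ('a::real_normed_vector \<Rightarrow> 'b::real_normed_vector) \<Rightarrow> 'a set \<Rightarrow> bool" where
  "C_k_on 0 f U \<longleftrightarrow> continuous_on U f"
| "C_k_on (Suc n) f U \<longleftrightarrow>
     (\<forall>x\<in>U. f differentiable (at x)) \<and> (\<forall>v. C_k_on n (\<lambda>x. frechet_derivative f (at x) v) U)"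

text \<open>Smoothness on an arbitrary subset \<open>S\<close> of a Euclidean space means local smooth extendability.
  If \<open>S\<close> is an embedded submanifold, this is smoothness on the manifold \<open>S\<close>.\<close>

definition smooth_map_on ::
  "'a::euclidean_space set \<Rightarrow> ('a \<Rightarrow> 'b::real_normed_vector) \<Rightarrow> bool" where
  "smooth_map_on S f \<longleftrightarrow>
     (\<forall>x\<in>S. \<exists>U F. open U \<and> x \<in> U \<and> (\<forall>n. C_k_on n F U) \<and> (\<forall>y\<in>S \<inter> U. F y = f y))"


section \<open>The Jacobi group\<close>

definition mat2 :: "complex \<Rightarrow> complex \<Rightarrow> complex \<Rightarrow> complex \<Rightarrow> complex^2^2" where
  "mat2 p q r s = vector [vector [p, q], vector [r, s]]"

definition SU11 :: "(complex^2^2) set" where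
  "SU11 = {mat2 a b (cnj b) (cnj a) |a b. (cmod a)\<^sup>2 - (cmod b)\<^sup>2 = 1}"

definition mat_exp :: "complex^2^2 \<Rightarrow> complex^2^2" where
  "mat_exp X = (\<Sum>n. (1 / fact n) *\<^sub>R ((\<lambda>M. X ** M) ^^ n) (mat 1))"

definition su11 :: "real \<Rightarrow> complex \<Rightarrow> complex^2^2" where
  "su11 \<theta> y = mat2 (\<i> * of_real \<theta>) y (cnj y) (- \<i> * of_real \<theta>)"

definition theta_h :: "complex \<Rightarrow> complex \<Rightarrow> real" where
  "theta_h \<beta> \<gamma> = Im (\<beta> * cnj \<gamma>)"

text \<open>The element \<open>(\<alpha>, s, g)\<close> stands for the product of \<open>exp (is1 + \<alpha>a\<^sup>+ - \<alpha>\<^sup>*a)\<close> in the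
  Heisenberg-Weyl group with \<open>g\<close> in \<open>SU(1,1)\<close>. By the commutation relations, conjugation by \<open>g\<close>
  turns \<open>\<alpha>\<close> into \<open>g\<^sub>1\<^sub>1\<alpha> + g\<^sub>1\<^sub>2\<alpha>\<^sup>*\<close>, and the Heisenberg cocycle is \<open>Im (\<alpha>\<beta>\<^sup>*)\<close>.\<close>

type_synonym jacobi = "complex \<times> real \<times> (complex^2^2)"

definition jacobi_group :: "jacobi set" where
  "jacobi_group = {(\<alpha>, s, g). g \<in> SU11}"

definition su11_act :: "complex^2^2 \<Rightarrow> complex \<Rightarrow> complex" where
  "su11_act g \<alpha> = g $ 1 $ 1 * \<alpha> + g $ 1 $ 2 * cnj \<alpha>"

fun jacobi_mult :: "jacobi \<Rightarrow> jacobi \<Rightarrow> jacobi" where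
  "jacobi_mult (\<alpha>, s, g) (\<beta>, t, h) =
     (\<alpha> + su11_act g \<beta>, s + t + theta_h \<alpha> (su11_act g \<beta>), g ** h)"


section \<open>Unitary representations of the Jacobi group\<close>

definition unitary_rep :: "(jacobi \<Rightarrow> 'h::complex_inner \<Rightarrow> 'h) \<Rightarrow> bool" where
  "unitary_rep \<pi> \<longleftrightarrow>
     (\<forall>x\<in>jacobi_group. unitary_op (\<pi> x)) \<and>
     (\<forall>x\<in>jacobi_group. \<forall>y\<in>jacobi_group. \<pi> (jacobi_mult x y) = \<pi> x \<circ> \<pi> y) \<and>
     (\<forall>v. continuous_on jacobi_group (\<lambda>x. \<pi> x v))"

definition smooth_vectors :: "(jacobi \<Rightarrow> 'h::complex_inner \<Rightarrow> 'h) \<Rightarrow> 'h set" where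
  "smooth_vectors \<pi> = {v. smooth_map_on jacobi_group (\<lambda>x. \<pi> x v)}"

text \<open>The operators \<open>ann\<close>, \<open>cre\<close>, \<open>K0\<close>, \<open>Kp\<close>, \<open>Km\<close> represent \<open>a\<close>, \<open>a\<^sup>+\<close>, \<open>K\<^sub>0\<close>, \<open>K\<^sub>+\<close>, \<open>K\<^sub>-\<close>.
  The assumptions \<open>derived_heis\<close> and \<open>derived_su11\<close> say that the derived representation, extended complex
  linearly, sends the Lie algebra elements to these operators; they determine the operators on the
  smooth vectors uniquely. The remaining assumptions on the operators are the standard properties
  of a derived unitary representation. Their values outside the smooth vectors are irrelevant.\<close>

locale jacobi_representation =
  fixes \<pi> :: "jacobi \<Rightarrow> 'h::{complex_inner, polish_space} \<Rightarrow> 'h"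
    and ann cre K0 Kp Km :: "'h \<Rightarrow> 'h"
  assumes rep: "unitary_rep \<pi>"
    and dense: "closure (smooth_vectors \<pi>) = UNIV"
    and endo: "linear_endo_on (smooth_vectors \<pi>) ann" "linear_endo_on (smooth_vectors \<pi>) cre"
      "linear_endo_on (smooth_vectors \<pi>) K0" "linear_endo_on (smooth_vectors \<pi>) Kp"
      "linear_endo_on (smooth_vectors \<pi>) Km"
    and derived_heis: "\<And>s x v. v \<in> smooth_vectors \<pi> \<Longrightarrow>
      ((\<lambda>t. \<pi> (of_real t * x, t * s, mat 1) v) has_vector_derivative
         (\<i> * of_real s) *\<^sub>C v + x *\<^sub>C cre v - cnj x *\<^sub>C ann v) (at 0)"
    and derived_su11: "\<And>\<theta> y v. v \<in> smooth_vectors \<pi> \<Longrightarrow>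
      ((\<lambda>t. \<pi> (0, 0, mat_exp (t *\<^sub>R su11 \<theta> y)) v) has_vector_derivative
         (2 * \<i> * of_real \<theta>) *\<^sub>C K0 v + y *\<^sub>C Kp v - cnj y *\<^sub>C Km v) (at 0)"
    and comm: "\<And>v. v \<in> smooth_vectors \<pi> \<Longrightarrow> ann (cre v) - cre (ann v) = v"
      "\<And>v. v \<in> smooth_vectors \<pi> \<Longrightarrow> K0 (Kp v) - Kp (K0 v) = Kp v"
      "\<And>v. v \<in> smooth_vectors \<pi> \<Longrightarrow> K0 (Km v) - Km (K0 v) = - Km v"
      "\<And>v. v \<in> smooth_vectors \<pi> \<Longrightarrow> Km (Kp v) - Kp (Km v) = 2 *\<^sub>C K0 v"
      "\<And>v. v \<in> smooth_vectors \<pi> \<Longrightarrow> ann (Kp v) - Kp (ann v) = cre v"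
      "\<And>v. v \<in> smooth_vectors \<pi> \<Longrightarrow> Km (cre v) - cre (Km v) = ann v"
      "\<And>v. v \<in> smooth_vectors \<pi> \<Longrightarrow> Kp (cre v) - cre (Kp v) = 0"
      "\<And>v. v \<in> smooth_vectors \<pi> \<Longrightarrow> Km (ann v) - ann (Km v) = 0"
      "\<And>v. v \<in> smooth_vectors \<pi> \<Longrightarrow> K0 (cre v) - cre (K0 v) = (1 / 2) *\<^sub>C cre v"
      "\<And>v. v \<in> smooth_vectors \<pi> \<Longrightarrow> K0 (ann v) - ann (K0 v) = - ((1 / 2) *\<^sub>C ann v)"
    and adj: "formal_adjoint_on (smooth_vectors \<pi>) cre ann"
      "formal_adjoint_on (smooth_vectors \<pi>) K0 K0" "formal_adjoint_on (smooth_vectors \<pi>) Kp Km"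

text \<open>The real span in \<open>cyclic\<close> is the complex span of the orbit, since all complex multiples of
  orbit vectors are included.\<close>

locale jacobi_lowest_weight = jacobi_representation \<pi> ann cre K0 Kp Km
  for \<pi> :: "jacobi \<Rightarrow> 'h::{complex_inner, polish_space} \<Rightarrow> 'h" and ann cre K0 Kp Km :: "'h \<Rightarrow> 'h" +
  fixes e0 :: 'h and k :: real
  assumes e0_smooth: "e0 \<in> smooth_vectors \<pi>"
    and cyclic: "closure (span {c *\<^sub>C \<pi> x e0 |c x. x \<in> jacobi_group}) = UNIV"
    and e0_ann: "ann e0 = 0" and e0_Km: "Km e0 = 0" and e0_K0: "K0 e0 = of_real k *\<^sub>C e0"
    and k_pos: "k > 0" and k_half_int: "2 * k \<in> real ` {2..}"

definition coherent ::
  "('h::complex_inner \<Rightarrow> 'h) \<Rightarrow> ('h \<Rightarrow> 'h) \<Rightarrow> 'h \<Rightarrow> complex \<Rightarrow> complex \<Rightarrow> 'h" where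
  "coherent cre Kp e0 z w =
     (\<Sum>n. (1 / fact n) *\<^sub>R ((\<lambda>v. z *\<^sub>C cre v + w *\<^sub>C Kp v) ^^ n) e0)"

definition displacement ::
  "'h::complex_inner set \<Rightarrow> ('h \<Rightarrow> 'h) \<Rightarrow> ('h \<Rightarrow> 'h) \<Rightarrow> complex \<Rightarrow> 'h \<Rightarrow> 'h" where
  "displacement V ann cre \<alpha> = op_exp V (\<lambda>v. \<alpha> *\<^sub>C cre v - cnj \<alpha> *\<^sub>C ann v)"

definition SU11_rep :: "(jacobi \<Rightarrow> 'h \<Rightarrow> 'h) \<Rightarrow> complex^2^2 \<Rightarrow> 'h \<Rightarrow> 'h" where
  "SU11_rep \<pi> g = \<pi> (0, 0, g)"

end

theory Submission
  imports Defs "HOL-Real_Asymp.Real_Asymp"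
begin

text \<open>Write \<open>B = z a\<^sup>+ + w K\<^sub>+\<close>, so that \<open>e(z, w)\<close> is the sum of \<open>v\<^sub>n = B^n e\<^sub>0 / n!\<close>. The commutation relations
  express \<open>a v\<^sub>n\<close>, \<open>K\<^sub>0 v\<^sub>n\<close> and \<open>K\<^sub>- v\<^sub>n\<close> by \<open>v\<close>, \<open>a\<^sup>+ v\<close> and \<open>K\<^sub>+ v\<close> with smaller indices, i.e. the Lie algebra
  acts on coherent states by first-order differential operators in \<open>z\<close> and \<open>w\<close>. Taking the inner product
  of \<open>(n + 1) v\<^bsub>n+1\<^esub> = B v\<^sub>n\<close> with \<open>v\<^bsub>n+1\<^esub>\<close> yields a quadratic recursion for the norms, which decay like \<open>\<rho>^n\<close> for
  every \<open>\<rho> > |w|\<close>. Hence a unitary one-parameter group with generator in the Lie algebra moves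
  coherent states along the integral curves of the corresponding vector field, up to a scalar that
  solves a linear differential equation. These curves are explicit for the Heisenberg group, for the
  rotations and for the boosts, and the latter two generate \<open>SU(1,1)\<close>. The displacement operator is
  well defined since two unitary groups with the same generator on smooth vectors agree on
  coherent states, which are total by cyclicity.\<close>

section \<open>Complex inner product spaces\<close>

text \<open>The vectors \<open>e z w\<close> are available only as infinite sums. They are not shown
  to be smooth, so the unbounded operators cannot be applied to them. The flow argument therefore
  uses finite partial sums, tested against smooth vectors, on which the generator is known. Partial
  sums violate the flow equation only by a boundary term; besides convergence, the norm estimates
  provide that this term vanishes uniformly on compact pieces of a curve. The vector field arises by
  reading \<open>a^+\<close> as d/dz and \<open>K_+\<close> as d/dw. Then \<open>a\<close> becomes z
  + w d/dz, \<open>K_0\<close> becomes k + (z/2) d/dz + w d/dw, and \<open>K_-\<close> becomes 2kw +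
  z^2/2 + zw d/dz + w^2 d/dw; the parts without derivative drive the scalar multiplier. Integrality
  of 2k turns the multiplier into an integer power of the denominator, so factors of group elements
  can be combined without choosing branches of a complex power.\<close>

lemma scaleC_zero_left [simp]: "0 *\<^sub>C (x::'a::complex_inner) = 0"
  using scaleC_of_real [of 0 x] by simp

lemma scaleC_one [simp]: "1 *\<^sub>C (x::'a::complex_inner) = x"
  using scaleC_of_real [of 1 x] by simp

lemma scaleC_zero_right [simp]: "c *\<^sub>C (0::'a::complex_inner) = 0"
  using scaleC_add_right [of c "0::'a" 0] by simp

lemma scaleC_minus_left: "(- c) *\<^sub>C (x::'a::complex_inner) = - (c *\<^sub>C x)"
  using scaleC_add_left [of c "-c" x] by (simp add: eq_neg_iff_add_eq_0 add.commute)

lemma scaleC_minus_right: "c *\<^sub>C (- x) = - (c *\<^sub>C (x::'a::complex_inner))"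
  using scaleC_add_right [of c x "-x"] by (simp add: eq_neg_iff_add_eq_0 add.commute)

lemma scaleC_diff_right: "c *\<^sub>C (x - y) = c *\<^sub>C x - c *\<^sub>C (y::'a::complex_inner)"
  using scaleC_add_right [of c x "-y"] by (simp add: scaleC_minus_right)

lemma scaleC_scaleR: "c *\<^sub>C (r *\<^sub>R x) = r *\<^sub>R (c *\<^sub>C (x::'a::complex_inner))"
  by (metis mult.commute scaleC_of_real scaleC_scaleC)

lemma cinner_zero_right [simp]: "cinner (x::'a::complex_inner) 0 = 0"
  using cinner_add_right [of x 0 0] by simp

lemma cinner_minus_right: "cinner (x::'a::complex_inner) (- y) = - cinner x y"
  using cinner_add_right [of x y "-y"] by (simp add: eq_neg_iff_add_eq_0 add.commute)

lemma cinner_diff_right: "cinner (x::'a::complex_inner) (y - z) = cinner x y - cinner x z"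
  using cinner_add_right [of x y "-z"] by (simp add: cinner_minus_right)

lemma cinner_scaleR_right: "cinner (x::'a::complex_inner) (r *\<^sub>R y) = of_real r * cinner x y"
  by (metis cinner_scaleC_right scaleC_of_real)

lemmas cinner_right_simps =
  cinner_add_right cinner_diff_right cinner_minus_right cinner_scaleC_right cinner_scaleR_right

lemma cinner_add_left: "cinner (x + y) (z::'a::complex_inner) = cinner x z + cinner y z"
  by (metis cinner_add_right cinner_commute complex_cnj_add)

lemma cinner_scaleC_left: "cinner (c *\<^sub>C x) (y::'a::complex_inner) = cnj c * cinner x y"
  by (metis cinner_commute cinner_scaleC_right complex_cnj_mult)

lemma cinner_zero_left [simp]: "cinner 0 (x::'a::complex_inner) = 0"
  using cinner_add_left [of 0 0 x] by simp

lemma cinner_self: "cinner x x = of_real ((norm (x::'a::complex_inner))\<^sup>2)"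
proof -
  have "Im (cinner x x) = 0"
    using cinner_commute [of x x] by (metis cnj.simps(2) equal_neg_zero)
  then show ?thesis
    by (simp add: complex_eq_iff Re_cinner power2_norm_eq_inner)
qed

text \<open>Pairing with an arbitrary \<open>u\<close> turns vector identities with complex
  coefficients into identities in \<open>complex\<close>, where ring normalisation applies. Most
  algebra below is done this way.\<close>

lemma cinner_eqI: "x = y" if "\<And>u. cinner u x = cinner u (y::'a::complex_inner)"
proof -
  have "cinner (x - y) (x - y) = 0"
    using that by (simp add: cinner_right_simps)
  then show ?thesis
    by (simp add: cinner_self)
qed

lemma norm_scaleC: "norm (c *\<^sub>C (x::'a::complex_inner)) = cmod c * norm x"
proof -
  have "of_real ((norm (c *\<^sub>C x))\<^sup>2) = cinner (c *\<^sub>C x) (c *\<^sub>C x)"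
    by (rule cinner_self [symmetric])
  also have "\<dots> = (c * cnj c) * cinner x x"
    by (simp add: cinner_scaleC_left cinner_scaleC_right)
  also have "\<dots> = of_real ((cmod c * norm x)\<^sup>2)"
    by (simp only: cinner_self complex_norm_square [symmetric] power_mult_distrib of_real_mult)
  finally have "(norm (c *\<^sub>C x))\<^sup>2 = (cmod c * norm x)\<^sup>2"
    by (simp only: of_real_eq_iff)
  then show ?thesis
    by (simp add: power2_eq_iff_nonneg)
qed

lemma bounded_bilinear_scaleC: "bounded_bilinear (scaleC :: complex \<Rightarrow> 'a \<Rightarrow> 'a::complex_inner)"
proof
  fix r :: real and c :: complex and x :: 'a
  show "(r *\<^sub>R c) *\<^sub>C x = r *\<^sub>R c *\<^sub>C x"
    by (metis scaleC_of_real scaleC_scaleC scaleR_conv_of_real)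
  show "\<exists>K. \<forall>c (x::'a). norm (c *\<^sub>C x) \<le> norm c * norm x * K"
    by (rule exI [of _ 1]) (simp add: norm_scaleC)
qed (simp_all add: scaleC_add_left scaleC_add_right scaleC_scaleR)

lemmas bounded_linear_scaleC_right =
  bounded_bilinear.bounded_linear_right [OF bounded_bilinear_scaleC]

lemma has_vector_derivative_scaleC:
  assumes "(c has_vector_derivative c') (at t)"
    and "(f has_vector_derivative f') (at t)"
  shows "((\<lambda>s. c s *\<^sub>C (f s :: 'a::complex_inner)) has_vector_derivative
    (c t *\<^sub>C f' + c' *\<^sub>C f t)) (at t)"
  by (rule bounded_bilinear.has_vector_derivative [OF bounded_bilinear_scaleC assms])

lemma norm_cinner_le: "cmod (cinner x y) \<le> norm x * norm (y::'a::complex_inner)"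
proof (cases "cinner x y = 0")
  case False
  \<comment> \<open>The phase that makes the inner product with \<open>y\<close> real and
    nonnegative, which reduces the claim to the real Cauchy-Schwarz inequality.\<close>
  define c where "c = cnj (cinner x y) / cmod (cinner x y)"
  have c: "cmod c = 1"
    using False by (simp add: c_def norm_divide)
  have "c * cinner x y = of_real (cmod (cinner x y))"
    using False complex_norm_square [of "cinner x y"]
    by (simp add: c_def field_simps power2_eq_square)
  then have "cmod (cinner x y) = Re (cinner x (c *\<^sub>C y))"
    by (simp add: cinner_scaleC_right)
  also have "\<dots> = inner x (c *\<^sub>C y)"
    by (rule Re_cinner)
  also have "\<dots> \<le> norm x * norm (c *\<^sub>C y)"
    by (rule norm_cauchy_schwarz)
  finally show ?thesis
    by (simp add: norm_scaleC c)
qed simp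

text \<open>The sort \<open>{real_normed_vector, complete_space}\<close> is not contained in the class \<open>banach\<close>, so the
  library version does not apply.\<close>

lemma summable_norm_cancel_complete:
  fixes f :: "nat \<Rightarrow> 'a::{real_normed_vector, complete_space}"
  assumes "summable (\<lambda>n. norm (f n))"
  shows "summable f"
proof -
  have "Cauchy (\<lambda>n. \<Sum>i<n. f i)"
  proof (rule CauchyI')
    fix e :: real assume "0 < e"
    then obtain M where M: "\<And>m n. M \<le> m \<Longrightarrow> norm (\<Sum>i = m..<n. norm (f i)) < e"
      using assms unfolding summable_Cauchy by blast
    show "\<exists>M. \<forall>m\<ge>M. \<forall>n>m. dist (\<Sum>i<m. f i) (\<Sum>i<n. f i) < e"
    proof (intro exI allI impI)
      fix m n assume mn: "M \<le> m" "m < n"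
      have "dist (\<Sum>i<m. f i) (\<Sum>i<n. f i) = norm ((\<Sum>i<n. f i) - (\<Sum>i<m. f i))"
        by (simp add: dist_norm norm_minus_commute)
      also have "(\<Sum>i<n. f i) - (\<Sum>i<m. f i) = (\<Sum>i = m..<n. f i)"
        using mn by (simp add: lessThan_atLeast0 sum_diff_nat_ivl)
      also have "norm \<dots> \<le> (\<Sum>i = m..<n. norm (f i))"
        by (rule norm_sum)
      also have "\<dots> < e"
        using M [OF mn(1), of n] by simp
      finally show "dist (\<Sum>i<m. f i) (\<Sum>i<n. f i) < e" .
    qed
  qed
  then show ?thesis
    by (simp add: summable_iff_convergent Cauchy_convergent)
qed

section \<open>Unitary groups\<close>

lemma unitary_op_bounded_linear:
  assumes "unitary_op (T :: 'a::complex_inner \<Rightarrow> 'a)"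
  shows "bounded_linear T"
proof
  fix x y :: 'a and r :: real
  show "T (x + y) = T x + T y"
    using assms by (simp add: unitary_op_def)
  show "T (r *\<^sub>R x) = r *\<^sub>R T x"
    using assms by (metis scaleC_of_real unitary_op_def)
  show "\<exists>K. \<forall>x. norm (T x) \<le> norm x * K"
  proof (intro exI allI)
    fix x
    show "norm (T x) \<le> norm x * 1"
      using assms cinner_self [of x] cinner_self [of "T x"]
      by (simp add: unitary_op_def power2_eq_iff_nonneg del: of_real_power)
  qed
qed

lemma unitary_op_scaleC: "unitary_op T \<Longrightarrow> T (c *\<^sub>C x) = c *\<^sub>C T x"
  by (simp add: unitary_op_def)

lemma unitary_op_inner: "unitary_op T \<Longrightarrow> inner (T x) (T y) = inner x y"
  by (metis Re_cinner unitary_op_def)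

lemma unitary_op_norm: "unitary_op T \<Longrightarrow> norm (T x) = norm x"
  by (simp add: norm_eq_sqrt_inner unitary_op_inner)

context
  fixes U :: "real \<Rightarrow> 'a::complex_inner \<Rightarrow> 'a"
  assumes U: "unitary_group U"
begin

lemma unitary_group_op: "unitary_op (U t)"
  using U by (simp add: unitary_group_def)

lemma unitary_group_add: "U (s + t) x = U s (U t x)"
  using U by (simp add: unitary_group_def)

text \<open>\<open>U 0\<close> is idempotent by the group law, and an isometry kills no nonzero
  vector.\<close>

lemma unitary_group_zero: "U 0 x = x"
proof -
  have "U 0 (U 0 x) = U 0 x"
    using unitary_group_add [of 0 0 x] by simp
  then have "inner (U 0 (U 0 x - x)) (U 0 (U 0 x - x)) = 0"
    using unitary_op_bounded_linear [OF unitary_group_op [of 0]]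
    by (simp add: linear_diff bounded_linear.linear)
  then show ?thesis
    by (simp add: unitary_op_inner unitary_group_op)
qed

lemma unitary_group_inner: "inner (U t x) y = inner x (U (- t) y)"
  using unitary_op_inner [OF unitary_group_op, of t x "U (- t) y"]
  by (simp add: unitary_group_add [symmetric] unitary_group_zero)

lemma unitary_group_derivative:
  assumes "((\<lambda>t. U t v) has_vector_derivative v') (at 0)"
  shows "((\<lambda>t. U t v) has_vector_derivative U t v') (at t)"
proof -
  have "((\<lambda>s. U (s - t) v) has_vector_derivative 1 *\<^sub>R v') (at t)"
    by (rule vector_diff_chain_at [where f = "\<lambda>s. s - t" and g = "\<lambda>s. U s v", unfolded o_def])
      (use assms in \<open>auto intro!: derivative_eq_intros\<close>)
  then have "((\<lambda>s. U t (U (s - t) v)) has_vector_derivative U t (1 *\<^sub>R v')) (at t)"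
    by (rule bounded_linear.has_vector_derivative
        [OF unitary_op_bounded_linear [OF unitary_group_op]])
  then show ?thesis
    by (simp add: unitary_group_add [symmetric])
qed

text \<open>Both sides are the derivative of s \<mapsto> \<open>inner (U s u) v\<close>, the second
  one computed after moving \<open>U s\<close> to the other side as \<open>U (- s)\<close>.\<close>

lemma unitary_group_skew:
  assumes u: "((\<lambda>t. U t u) has_vector_derivative u') (at 0)"
    and v: "((\<lambda>t. U t v) has_vector_derivative v') (at 0)"
  shows "inner (U t u') v = - inner (U t u) v'"
proof -
  have "((\<lambda>s. inner (U s u) v) has_vector_derivative inner (U t u') v) (at t)"
    by (rule bounded_linear.has_vector_derivative [OF bounded_linear_inner_left])
      (rule unitary_group_derivative [OF u])
  then have 1: "((\<lambda>s. inner u (U (- s) v)) has_vector_derivative inner (U t u') v) (at t)"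
    by (simp add: unitary_group_inner)
  have "((\<lambda>s. U (- s) v) has_vector_derivative (- 1) *\<^sub>R U (- t) v') (at t)"
    by (rule vector_diff_chain_at [where f = "\<lambda>s. - s" and g = "\<lambda>s. U s v", unfolded o_def])
      (auto intro!: derivative_eq_intros unitary_group_derivative [OF v])
  then have "((\<lambda>s. inner u (U (- s) v)) has_vector_derivative inner u ((- 1) *\<^sub>R U (- t) v')) (at t)"
    by (rule bounded_linear.has_vector_derivative [OF bounded_linear_inner_right])
  with 1 have "inner (U t u') v = inner u ((- 1) *\<^sub>R U (- t) v')"
    by (rule vector_derivative_unique_at)
  then show ?thesis
    by (simp add: unitary_group_inner)
qed

end

section \<open>Smooth maps\<close>

text \<open>On an open set the Frechet derivative depends only on the values there, so the induction
  may pass to derivatives. This allows the closure properties below to replace the derivative of a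
  sum or a composition by its explicit formula.\<close>

lemma C_k_on_cong:
  assumes "open U" "\<And>x. x \<in> U \<Longrightarrow> f x = g x" "C_k_on n f U"
  shows "C_k_on n g U"
  using assms(2,3)
proof (induction n arbitrary: f g)
  case 0
  then show ?case
    by (simp cong: continuous_on_cong)
next
  case (Suc n)
  have fd: "(g has_derivative frechet_derivative f (at x)) (at x)" if "x \<in> U" for x
  proof (rule has_derivative_transform_within_open [OF _ \<open>open U\<close> that])
    show "(f has_derivative frechet_derivative f (at x)) (at x)"
      using Suc.prems that by (simp add: frechet_derivative_works [symmetric])
  qed (use Suc.prems in simp)
  have "C_k_on n (\<lambda>x. frechet_derivative g (at x) v) U" for v
  proof (rule Suc.IH)
    show "C_k_on n (\<lambda>x. frechet_derivative f (at x) v) U"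
      using Suc.prems by simp
  qed (metis fd frechet_derivative_at)
  then show ?case
    using fd by (auto simp: differentiable_def)
qed

lemma C_k_on_subset: "C_k_on n f U \<Longrightarrow> U' \<subseteq> U \<Longrightarrow> C_k_on n f U'"
  by (induction n arbitrary: f) (auto intro: continuous_on_subset)

lemma C_k_on_add:
  assumes "open U" "C_k_on n f U" "C_k_on n g U"
  shows "C_k_on n (\<lambda>x. f x + g x) U"
  using assms(2,3)
proof (induction n arbitrary: f g)
  case 0
  then show ?case
    by (simp add: continuous_on_add)
next
  case (Suc n)
  have d: "((\<lambda>x. f x + g x) has_derivative
      (\<lambda>v. frechet_derivative f (at x) v + frechet_derivative g (at x) v)) (at x)" if "x \<in> U" for x
    by (rule has_derivative_add) (use Suc.prems that in \<open>simp_all add: frechet_derivative_works\<close>)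
  show ?case
    unfolding C_k_on.simps
  proof (intro conjI ballI allI)
    fix v
    have "C_k_on n (\<lambda>x. frechet_derivative f (at x) v + frechet_derivative g (at x) v) U"
      using Suc by simp
    then show "C_k_on n (\<lambda>x. frechet_derivative (\<lambda>x. f x + g x) (at x) v) U"
      by (rule C_k_on_cong [OF \<open>open U\<close>, rotated])
        (rule fun_cong [OF frechet_derivative_at [OF d]])
  qed (use Suc.prems in simp)
qed

lemma C_k_on_bounded_linear:
  assumes "open U" "bounded_linear L" "C_k_on n f U"
  shows "C_k_on n (\<lambda>x. L (f x)) U"
  using assms(3)
proof (induction n arbitrary: f)
  case 0
  then show ?case
    by (simp add: bounded_linear.continuous_on [OF assms(2)])
next
  case (Suc n)
  have d: "((\<lambda>x. L (f x)) has_derivative (\<lambda>v. L (frechet_derivative f (at x) v))) (at x)"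
    if "x \<in> U" for x
    by (rule bounded_linear.has_derivative [OF assms(2)])
      (use Suc.prems that in \<open>simp add: frechet_derivative_works\<close>)
  show ?case
    unfolding C_k_on.simps
  proof (intro conjI ballI allI)
    fix v
    have "C_k_on n (\<lambda>x. L (frechet_derivative f (at x) v)) U"
      using Suc by simp
    then show "C_k_on n (\<lambda>x. frechet_derivative (\<lambda>x. L (f x)) (at x) v) U"
      by (rule C_k_on_cong [OF \<open>open U\<close>, rotated])
        (rule fun_cong [OF frechet_derivative_at [OF d]])
  qed (use d in \<open>auto simp: differentiable_def\<close>)
qed

lemma smooth_map_onE:
  assumes "smooth_map_on S f" "x \<in> S"
  obtains U F where "open U" "x \<in> U" "\<forall>n. C_k_on n F U" "\<forall>y\<in>S \<inter> U. F y = f y"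
proof -
  have "\<exists>U F. open U \<and> x \<in> U \<and> (\<forall>n. C_k_on n F U) \<and> (\<forall>y\<in>S \<inter> U. F y = f y)"
    using assms(1) [unfolded smooth_map_on_def] assms(2) by (rule bspec)
  then show ?thesis
    by (elim exE conjE) (rule that)
qed

lemma smooth_map_onI:
  assumes "\<And>x. x \<in> S \<Longrightarrow>
    \<exists>U F. open U \<and> x \<in> U \<and> (\<forall>n. C_k_on n F U) \<and> (\<forall>y\<in>S \<inter> U. F y = f y)"
  shows "smooth_map_on S f"
  unfolding smooth_map_on_def by (rule ballI) (rule assms)

lemma smooth_map_on_add:
  assumes "smooth_map_on S f" "smooth_map_on S g"
  shows "smooth_map_on S (\<lambda>x. f x + g x)"
proof (rule smooth_map_onI)
  fix x assume x: "x \<in> S"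
  obtain U F where 1: "open U" "x \<in> U" "\<forall>n. C_k_on n F U" "\<forall>y\<in>S \<inter> U. F y = f y"
    by (rule smooth_map_onE [OF assms(1) x])
  obtain U' G where 2: "open U'" "x \<in> U'" "\<forall>n. C_k_on n G U'" "\<forall>y\<in>S \<inter> U'. G y = g y"
    by (rule smooth_map_onE [OF assms(2) x])
  show "\<exists>U F. open U \<and> x \<in> U \<and> (\<forall>n. C_k_on n F U) \<and> (\<forall>y\<in>S \<inter> U. F y = f y + g y)"
  proof (rule exI [of _ "U \<inter> U'"], rule exI [of _ "\<lambda>x. F x + G x"], intro conjI allI ballI)
    show "open (U \<inter> U')"
      using 1(1) 2(1) by (rule open_Int)
    show "C_k_on n (\<lambda>x. F x + G x) (U \<inter> U')" for n
      by (intro C_k_on_add open_Int 1 2 C_k_on_subset [OF spec [OF 1(3)]] C_k_on_subset [OF spec [OF 2(3)]]) simp_all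
  qed (simp_all add: 1 2)
qed

lemma smooth_map_on_bounded_linear:
  assumes "bounded_linear L" "smooth_map_on S f"
  shows "smooth_map_on S (\<lambda>x. L (f x))"
proof (rule smooth_map_onI)
  fix x assume x: "x \<in> S"
  obtain U F where 1: "open U" "x \<in> U" "\<forall>n. C_k_on n F U" "\<forall>y\<in>S \<inter> U. F y = f y"
    by (rule smooth_map_onE [OF assms(2) x])
  show "\<exists>U F. open U \<and> x \<in> U \<and> (\<forall>n. C_k_on n F U) \<and> (\<forall>y\<in>S \<inter> U. F y = L (f y))"
    by (rule exI [of _ U], rule exI [of _ "\<lambda>x. L (F x)"])
      (simp add: 1 C_k_on_bounded_linear assms(1))
qed

section \<open>The coherent state series\<close>

lemma scaleC_cancel:
  fixes x y :: "'a::complex_inner"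
  assumes "c *\<^sub>C x = c *\<^sub>C y" "c \<noteq> 0"
  shows "x = y"
proof -
  have "inverse c *\<^sub>C c *\<^sub>C x = inverse c *\<^sub>C c *\<^sub>C y"
    using assms(1) by simp
  then show ?thesis
    using assms(2) by (simp add: scaleC_scaleC)
qed

text \<open>The convention v_{-1} = 0 keeps all formulas with v_{n-1} and v_{n-2} valid at n = 0 and
  n = 1.\<close>

primrec shift :: "(nat \<Rightarrow> 'a::zero) \<Rightarrow> nat \<Rightarrow> 'a" where
  "shift f 0 = 0"
| "shift f (Suc n) = f n"

context jacobi_lowest_weight
begin

section \<open>The smooth vectors as a common invariant domain\<close>

abbreviation V :: "'h set" where "V \<equiv> smooth_vectors \<pi>"

lemma V_add [simp]: "u \<in> V \<Longrightarrow> v \<in> V \<Longrightarrow> u + v \<in> V"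
  unfolding smooth_vectors_def mem_Collect_eq
proof -
  assume "smooth_map_on jacobi_group (\<lambda>x. \<pi> x u)" "smooth_map_on jacobi_group (\<lambda>x. \<pi> x v)"
  then have "smooth_map_on jacobi_group (\<lambda>x. \<pi> x u + \<pi> x v)"
    by (rule smooth_map_on_add)
  \<comment> \<open>Smoothness on \<open>jacobi_group\<close> depends only on the values there, and
    this is where \<open>\<pi> x\<close> is known to be linear.\<close>
  moreover have "\<pi> x (u + v) = \<pi> x u + \<pi> x v" if "x \<in> jacobi_group" for x
    using rep that by (simp add: unitary_rep_def unitary_op_def)
  ultimately show "smooth_map_on jacobi_group (\<lambda>x. \<pi> x (u + v))"
    by (simp add: smooth_map_on_def)
qed

lemma V_scaleC [simp]: "v \<in> V \<Longrightarrow> c *\<^sub>C v \<in> V"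
  unfolding smooth_vectors_def mem_Collect_eq
proof -
  assume "smooth_map_on jacobi_group (\<lambda>x. \<pi> x v)"
  then have "smooth_map_on jacobi_group (\<lambda>x. c *\<^sub>C \<pi> x v)"
    by (rule smooth_map_on_bounded_linear [OF bounded_linear_scaleC_right])
  moreover have "\<pi> x (c *\<^sub>C v) = c *\<^sub>C \<pi> x v" if "x \<in> jacobi_group" for x
    using rep that by (simp add: unitary_rep_def unitary_op_def)
  ultimately show "smooth_map_on jacobi_group (\<lambda>x. \<pi> x (c *\<^sub>C v))"
    by (simp add: smooth_map_on_def)
qed

lemma V_zero [simp]: "0 \<in> V"
  using V_scaleC [OF e0_smooth, of 0] by simp

lemma linear_endo_simps:
  assumes "linear_endo_on V T"
  shows "v \<in> V \<Longrightarrow> T v \<in> V" "u \<in> V \<Longrightarrow> v \<in> V \<Longrightarrow> T (u + v) = T u + T v"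
    "v \<in> V \<Longrightarrow> T (c *\<^sub>C v) = c *\<^sub>C T v" "T 0 = 0"
proof -
  show 1: "v \<in> V \<Longrightarrow> T (c *\<^sub>C v) = c *\<^sub>C T v" for c v
    using assms by (simp add: linear_endo_on_def)
  show "T 0 = 0"
    using 1 [of 0 0] by simp
qed (use assms in \<open>auto simp: linear_endo_on_def\<close>)

lemmas operator_simps [simp] =
  linear_endo_simps [OF endo(1)] linear_endo_simps [OF endo(2)] linear_endo_simps [OF endo(3)]
  linear_endo_simps [OF endo(4)] linear_endo_simps [OF endo(5)]

text \<open>Oriented as rewrite rules towards a normal order: \<open>ann\<close>, \<open>Km\<close>
  and \<open>K0\<close> move to the right, and \<open>cre\<close> ends up left of
  \<open>Kp\<close>.\<close>

lemma commute:
  assumes "v \<in> V"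
  shows "ann (cre v) = cre (ann v) + v" "K0 (Kp v) = Kp (K0 v) + Kp v"
    "Km (Kp v) = Kp (Km v) + 2 *\<^sub>C K0 v" "ann (Kp v) = Kp (ann v) + cre v"
    "Km (cre v) = cre (Km v) + ann v" "Kp (cre v) = cre (Kp v)"
    "K0 (cre v) = cre (K0 v) + (1 / 2) *\<^sub>C cre v"
  using comm(1,2,4,5,6,7,9) [OF assms] by (simp_all add: diff_eq_eq add.commute)

primrec coh :: "complex \<Rightarrow> complex \<Rightarrow> nat \<Rightarrow> 'h" where
  "coh z w 0 = e0"
| "coh z w (Suc n) = (1 / of_nat (Suc n)) *\<^sub>C (z *\<^sub>C cre (coh z w n) + w *\<^sub>C Kp (coh z w n))"

lemma coh_V [simp]: "coh z w n \<in> V"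
  by (induction n) (simp_all add: e0_smooth)

lemma shift_coh_V [simp]: "shift (coh z w) n \<in> V" "shift (shift (coh z w)) n \<in> V"
proof -
  show *: "shift (coh z w) n \<in> V" for n
    by (cases n) simp_all
  show "shift (shift (coh z w)) n \<in> V"
    by (cases n) (simp_all add: *)
qed

lemma coh_eq_power:
  "(1 / fact n) *\<^sub>R ((\<lambda>v. z *\<^sub>C cre v + w *\<^sub>C Kp v) ^^ n) e0 = coh z w n"
proof -
  let ?B = "\<lambda>v. z *\<^sub>C cre v + w *\<^sub>C Kp v"
  have *: "(?B ^^ n) e0 = fact n *\<^sub>C coh z w n"
  proof (induction n)
    case (Suc n)
    have "(?B ^^ Suc n) e0 = ?B (fact n *\<^sub>C coh z w n)"
      by (simp add: Suc)
    also have "\<dots> = fact (Suc n) *\<^sub>C coh z w (Suc n)"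
      by (rule cinner_eqI) (simp add: cinner_right_simps field_simps del: of_nat_Suc)
    finally show ?case .
  qed simp
  show ?thesis
    unfolding * by (simp add: scaleC_scaleC flip: scaleC_of_real)
qed

lemma coherent_eq: "coherent cre Kp e0 z w = (\<Sum>n. coh z w n)"
  by (simp add: coherent_def coh_eq_power)

section \<open>Lie algebra action on the terms of the series\<close>

lemma creation_shift:
  "z *\<^sub>C cre (shift (coh z w) n) + w *\<^sub>C Kp (shift (coh z w) n) = of_nat n *\<^sub>C coh z w n"
  by (cases n) (simp_all add: scaleC_scaleC del: of_nat_Suc)

lemma creation_shift_shift:
  "z *\<^sub>C cre (shift (shift (coh z w)) n) + w *\<^sub>C Kp (shift (shift (coh z w)) n) =
    (of_nat n - 1) *\<^sub>C shift (coh z w) n"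
  by (cases n) (simp_all add: creation_shift)

lemma of_nat_Suc_scaleC_coh:
  "of_nat (Suc n) *\<^sub>C coh z w (Suc n) = z *\<^sub>C cre (coh z w n) + w *\<^sub>C Kp (coh z w n)"
  by (simp add: scaleC_scaleC del: of_nat_Suc)

text \<open>This is z + w d/dz term by term, since \<open>cre\<close> applied to v_{n-1} is the
  z-derivative of v_n. Multiplication by n + 1 turns v_{n+1} into B v_n; the commutator of
  \<open>ann\<close> with B contributes one copy of the right-hand side, and the induction
  hypothesis contributes n copies through B v_{n-1} = n v_n.\<close>

lemma ann_coh:
  "ann (coh z w n) = z *\<^sub>C shift (coh z w) n + w *\<^sub>C cre (shift (coh z w) n)"
proof (induction n)
  case 0
  then show ?case
    by (simp add: e0_ann)
next
  case (Suc n)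
  let ?c = "coh z w n" and ?s = "shift (coh z w) n"
  have 1: "cre (z *\<^sub>C cre ?s + w *\<^sub>C Kp ?s) = of_nat n *\<^sub>C cre ?c"
    unfolding creation_shift by simp
  show ?case
  proof (rule scaleC_cancel [of "of_nat (Suc n)"], rule cinner_eqI)
    fix u
    have 2: "z * cinner u (cre ?s) + w * cinner u (Kp ?s) = of_nat n * cinner u ?c"
      using arg_cong [OF creation_shift [of z w n], of "cinner u"]
      by (simp add: cinner_right_simps)
    have 3: "z * cinner u (cre (cre ?s)) + w * cinner u (cre (Kp ?s)) = of_nat n * cinner u (cre ?c)"
      using arg_cong [OF 1, of "cinner u"] by (simp add: cinner_right_simps)
    have "cinner u (of_nat (Suc n) *\<^sub>C ann (coh z w (Suc n))) =
        cinner u (ann (of_nat (Suc n) *\<^sub>C coh z w (Suc n)))"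
      by (simp del: coh.simps of_nat_Suc)
    also have "\<dots> = z * (cinner u ?c + z * cinner u (cre ?s) + w * cinner u (cre (cre ?s))) +
       w * (cinner u (cre ?c) + z * cinner u (Kp ?s) + w * cinner u (cre (Kp ?s)))"
      unfolding of_nat_Suc_scaleC_coh
      by (simp add: commute Suc cinner_right_simps algebra_simps)
    also have "\<dots> = z * cinner u ?c + w * cinner u (cre ?c) +
      z * (z * cinner u (cre ?s) + w * cinner u (Kp ?s)) +
      w * (z * cinner u (cre (cre ?s)) + w * cinner u (cre (Kp ?s)))"
      by (simp add: algebra_simps)
    also have "\<dots> = cinner u (of_nat (Suc n) *\<^sub>C
        (z *\<^sub>C shift (coh z w) (Suc n) + w *\<^sub>C cre (shift (coh z w) (Suc n))))"
      unfolding 2 3 by (simp add: cinner_right_simps algebra_simps)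
    finally show "cinner u (of_nat (Suc n) *\<^sub>C ann (coh z w (Suc n))) = \<dots>" .
  qed (simp del: of_nat_Suc)
qed

text \<open>\<open>Kp\<close> raises the weight by 1 but \<open>cre\<close> only by 1/2, so k + n
  overcounts the factors \<open>cre\<close>; the second summand is the correction. This form,
  explicit in n, serves the norm estimates and the computation of \<open>Km\<close>.\<close>

lemma K0_coh':
  "K0 (coh z w n) = (of_real k + of_nat n) *\<^sub>C coh z w n - (z / 2) *\<^sub>C cre (shift (coh z w) n)"
proof (induction n)
  case 0
  then show ?case
    by (simp add: e0_K0)
next
  case (Suc n)
  let ?c = "coh z w n" and ?s = "shift (coh z w) n"
  have 1: "cre (z *\<^sub>C cre ?s + w *\<^sub>C Kp ?s) = of_nat n *\<^sub>C cre ?c"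
    unfolding creation_shift by simp
  have IH: "K0 ?c = (of_real k + of_nat n) *\<^sub>C ?c + (- z / 2) *\<^sub>C cre ?s"
    by (simp add: Suc scaleC_minus_left)
  show ?case
  proof (rule scaleC_cancel [of "of_nat (Suc n)"], rule cinner_eqI)
    fix u
    have 2: "z * cinner u (cre ?c) + w * cinner u (Kp ?c) = of_nat (Suc n) * cinner u (coh z w (Suc n))"
      using arg_cong [OF creation_shift [of z w "Suc n"], of "cinner u"]
      by (simp add: cinner_right_simps del: of_nat_Suc coh.simps)
    have 3: "z * cinner u (cre (cre ?s)) + w * cinner u (cre (Kp ?s)) = of_nat n * cinner u (cre ?c)"
      using arg_cong [OF 1, of "cinner u"] by (simp add: cinner_right_simps)
    have "cinner u (of_nat (Suc n) *\<^sub>C K0 (coh z w (Suc n))) =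
        cinner u (K0 (of_nat (Suc n) *\<^sub>C coh z w (Suc n)))"
      by (simp del: coh.simps of_nat_Suc)
    also have "\<dots> = (of_real k + of_nat n + 1) * (z * cinner u (cre ?c) + w * cinner u (Kp ?c)) -
        (z / 2) * (z * cinner u (cre (cre ?s)) + w * cinner u (cre (Kp ?s))) -
        (z / 2) * cinner u (cre ?c)"
      unfolding of_nat_Suc_scaleC_coh
      by (simp add: commute IH cinner_right_simps algebra_simps)
    also have "\<dots> = cinner u (of_nat (Suc n) *\<^sub>C ((of_real k + of_nat (Suc n)) *\<^sub>C coh z w (Suc n) -
        (z / 2) *\<^sub>C cre (shift (coh z w) (Suc n))))"
      unfolding 2 3 by (simp add: cinner_right_simps algebra_simps del: coh.simps)
    finally show "cinner u (of_nat (Suc n) *\<^sub>C K0 (coh z w (Suc n))) = \<dots>" .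
  qed (simp del: of_nat_Suc)
qed

text \<open>Trading n v_n for B v_{n-1} makes the coefficients independent of n, which lets the
  defect of the flow equation telescope.\<close>

lemma K0_coh:
  "K0 (coh z w n) =
    of_real k *\<^sub>C coh z w n + (z / 2) *\<^sub>C cre (shift (coh z w) n) + w *\<^sub>C Kp (shift (coh z w) n)"
proof (rule cinner_eqI)
  fix u
  have "z * cinner u (cre (shift (coh z w) n)) + w * cinner u (Kp (shift (coh z w) n)) =
      of_nat n * cinner u (coh z w n)"
    using arg_cong [OF creation_shift [of z w n], of "cinner u"]
    by (simp add: cinner_right_simps)
  note this [symmetric, simp]
  show "cinner u (K0 (coh z w n)) = cinner u (of_real k *\<^sub>C coh z w n +
      (z / 2) *\<^sub>C cre (shift (coh z w) n) + w *\<^sub>C Kp (shift (coh z w) n))"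
    unfolding K0_coh' by (simp add: cinner_right_simps distrib_right)
qed

text \<open>For z = 0 this is the lowest weight identity K_- K_+^n e_0 = n (2k + n - 1) K_+^(n-1)
  e_0. The z^2 / 2 term comes from two factors \<open>cre\<close>: the first commutator yields
  \<open>ann\<close>, the second a scalar. At n = 0 the coefficient with - 1 multiplies a zero
  vector.\<close>

lemma Km_coh':
  "Km (coh z w n) = (w * (2 * of_real k + of_nat n - 1)) *\<^sub>C shift (coh z w) n +
    (z\<^sup>2 / 2) *\<^sub>C shift (shift (coh z w)) n"
proof (induction n)
  case 0
  then show ?case
    by (simp add: e0_Km)
next
  case (Suc n)
  let ?c = "coh z w n" and ?s = "shift (coh z w) n" and ?r = "shift (shift (coh z w)) n"
  show ?case
  proof (rule scaleC_cancel [of "of_nat (Suc n)"], rule cinner_eqI)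
    fix u
    have 2: "z * cinner u (cre ?s) + w * cinner u (Kp ?s) = of_nat n * cinner u ?c"
      using arg_cong [OF creation_shift [of z w n], of "cinner u"]
      by (simp add: cinner_right_simps)
    have 3: "z * cinner u (cre ?r) + w * cinner u (Kp ?r) = (of_nat n - 1) * cinner u ?s"
      using arg_cong [OF creation_shift_shift [of z w n], of "cinner u"]
      by (simp add: cinner_right_simps)
    have K0: "K0 ?c = (of_real k + of_nat n) *\<^sub>C ?c + (- z / 2) *\<^sub>C cre ?s"
      by (simp add: K0_coh' scaleC_minus_left)
    have "cinner u (of_nat (Suc n) *\<^sub>C Km (coh z w (Suc n))) =
        cinner u (Km (of_nat (Suc n) *\<^sub>C coh z w (Suc n)))"
      by (simp del: coh.simps of_nat_Suc)
    also have "\<dots> = w * (2 * of_real k + of_nat n - 1) * (z * cinner u (cre ?s) + w * cinner u (Kp ?s)) +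
        (z\<^sup>2 / 2) * (z * cinner u (cre ?r) + w * cinner u (Kp ?r)) +
        z\<^sup>2 * cinner u ?s + 2 * w * (of_real k + of_nat n) * cinner u ?c"
      unfolding of_nat_Suc_scaleC_coh
      by (simp add: commute Suc ann_coh K0 cinner_right_simps algebra_simps power2_eq_square)
    also have "\<dots> = cinner u (of_nat (Suc n) *\<^sub>C ((w * (2 * of_real k + of_nat (Suc n) - 1)) *\<^sub>C
        shift (coh z w) (Suc n) + (z\<^sup>2 / 2) *\<^sub>C shift (shift (coh z w)) (Suc n)))"
      unfolding 2 3 by (simp add: cinner_right_simps algebra_simps)
    finally show "cinner u (of_nat (Suc n) *\<^sub>C Km (coh z w (Suc n))) = \<dots>" .
  qed (simp del: of_nat_Suc)
qed

lemma Km_coh: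
  "Km (coh z w n) = (2 * of_real k * w) *\<^sub>C shift (coh z w) n +
    (z\<^sup>2 / 2) *\<^sub>C shift (shift (coh z w)) n +
    (z * w) *\<^sub>C cre (shift (shift (coh z w)) n) + w\<^sup>2 *\<^sub>C Kp (shift (shift (coh z w)) n)"
proof (rule cinner_eqI)
  fix u
  let ?s = "shift (coh z w) n" and ?r = "shift (shift (coh z w)) n"
  have "w * (z * cinner u (cre ?r) + w * cinner u (Kp ?r)) = w * ((of_nat n - 1) * cinner u ?s)"
    using arg_cong [OF creation_shift_shift [of z w n], of "cinner u"]
    by (simp add: cinner_right_simps)
  then show "cinner u (Km (coh z w n)) = cinner u ((2 * of_real k * w) *\<^sub>C ?s +
    (z\<^sup>2 / 2) *\<^sub>C ?r + (z * w) *\<^sub>C cre ?r + w\<^sup>2 *\<^sub>C Kp ?r)"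
    unfolding Km_coh' by (simp add: cinner_right_simps algebra_simps power2_eq_square)
qed

text \<open>Each term is a polynomial in z and w, and B can be differentiated like a scalar because
  \<open>cre\<close> and \<open>Kp\<close> commute. The unbounded \<open>cre\<close> and
  \<open>Kp\<close> cannot be pulled through a derivative, so the induction carries an arbitrary
  endomorphism \<open>T\<close> of the domain and absorbs them into it.\<close>

lemma coh_has_vector_derivative:
  assumes z: "(z has_vector_derivative z') (at t)" and w: "(w has_vector_derivative w') (at t)"
    and "linear_endo_on V T"
  shows "((\<lambda>t. T (coh (z t) (w t) n)) has_vector_derivative
    T (z' *\<^sub>C cre (shift (coh (z t) (w t)) n) + w' *\<^sub>C Kp (shift (coh (z t) (w t)) n))) (at t)"
  using assms(3)
proof (induction n arbitrary: T)
  case 0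
  then show ?case
    by (simp add: linear_endo_simps)
next
  case (Suc n)
  note T [simp] = linear_endo_simps [OF Suc.prems]
  let ?c = "\<lambda>t. coh (z t) (w t) n" and ?s = "shift (coh (z t) (w t)) n"
  let ?d = "z' *\<^sub>C cre ?s + w' *\<^sub>C Kp ?s"
  have endo: "linear_endo_on V (\<lambda>v. T (cre v))" "linear_endo_on V (\<lambda>v. T (Kp v))"
    by (simp_all add: linear_endo_on_def)
  have "((\<lambda>t. (1 / of_nat (Suc n)) *\<^sub>C (z t *\<^sub>C T (cre (?c t)) + w t *\<^sub>C T (Kp (?c t))))
      has_vector_derivative (1 / of_nat (Suc n)) *\<^sub>C
        ((z t *\<^sub>C T (cre ?d) + z' *\<^sub>C T (cre (?c t))) + (w t *\<^sub>C T (Kp ?d) + w' *\<^sub>C T (Kp (?c t))))) (at t)"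
    by (intro bounded_linear.has_vector_derivative [OF bounded_linear_scaleC_right]
        has_vector_derivative_add has_vector_derivative_scaleC z w Suc.IH [OF endo(1)] Suc.IH [OF endo(2)])
  moreover have "(1 / of_nat (Suc n)) *\<^sub>C
        ((z t *\<^sub>C T (cre ?d) + z' *\<^sub>C T (cre (?c t))) + (w t *\<^sub>C T (Kp ?d) + w' *\<^sub>C T (Kp (?c t)))) =
      T (z' *\<^sub>C cre (?c t) + w' *\<^sub>C Kp (?c t))" (is "?l = ?r")
  proof (rule cinner_eqI)
    fix u
    have 1: "T (cre (z t *\<^sub>C cre ?s + w t *\<^sub>C Kp ?s)) = of_nat n *\<^sub>C T (cre (?c t))"
      unfolding creation_shift by simp
    have 2: "T (Kp (z t *\<^sub>C cre ?s + w t *\<^sub>C Kp ?s)) = of_nat n *\<^sub>C T (Kp (?c t))"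
      unfolding creation_shift by simp
    have 3: "z t * cinner u (T (cre (cre ?s))) + w t * cinner u (T (cre (Kp ?s))) =
        of_nat n * cinner u (T (cre (?c t)))"
      using arg_cong [OF 1, of "cinner u"] by (simp add: cinner_right_simps)
    have 4: "z t * cinner u (T (cre (Kp ?s))) + w t * cinner u (T (Kp (Kp ?s))) =
        of_nat n * cinner u (T (Kp (?c t)))"
      using arg_cong [OF 2, of "cinner u"] by (simp add: cinner_right_simps commute)
    have "of_nat (Suc n) * cinner u ?l =
      z' * (z t * cinner u (T (cre (cre ?s))) + w t * cinner u (T (cre (Kp ?s)))) +
      w' * (z t * cinner u (T (cre (Kp ?s))) + w t * cinner u (T (Kp (Kp ?s)))) +
      z' * cinner u (T (cre (?c t))) + w' * cinner u (T (Kp (?c t)))"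
      by (simp add: cinner_right_simps commute algebra_simps del: of_nat_Suc)
    also have "\<dots> = of_nat (Suc n) * cinner u ?r"
      unfolding 3 4 by (simp add: cinner_right_simps algebra_simps)
    finally show "cinner u ?l = cinner u ?r"
      by (simp del: of_nat_Suc)
  qed
  ultimately show ?case
    by (simp del: of_nat_Suc)
qed

end

section \<open>Convergence of the coherent state series\<close>

text \<open>By \<open>ev\<close> the bound C \<rho>^n reproduces itself from some index on; the
  finitely many earlier steps only enlarge C. The summand Q / \<rho> accounts for x_{n-1} being
  bounded by C \<rho>^n / \<rho>. The constant is chosen before the sequence, which later gives
  uniformity in z and w.\<close>

lemma quadratic_recursion_bound:
  fixes P :: "nat \<Rightarrow> real"
  assumes \<rho>: "\<rho> > 0" and Q: "Q \<ge> 0" and P: "\<And>n. P n \<ge> 0"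
    and ev: "eventually (\<lambda>n. P n + Q / \<rho> \<le> real (Suc n) * \<rho>\<^sup>2) sequentially"
  obtains C where "C > 0"
    "\<And>x n. (\<And>n. x n \<ge> 0) \<Longrightarrow> x 0 \<le> c \<Longrightarrow>
      (\<And>n. real (Suc n) * (x (Suc n))\<^sup>2 \<le> P n * (x n)\<^sup>2 + Q * x n * shift x n) \<Longrightarrow>
      x n \<le> C * \<rho> ^ n"
proof -
  define adm where "adm x \<longleftrightarrow> (\<forall>n. x n \<ge> 0) \<and> x 0 \<le> c \<and>
    (\<forall>n. real (Suc n) * (x (Suc n))\<^sup>2 \<le> P n * (x n)\<^sup>2 + Q * x n * shift x n)" for x :: "nat \<Rightarrow> real"
  have step: "x (Suc n) \<le> D * C * \<rho> ^ Suc n"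
    if x: "adm x" and C: "C > 0" "x n \<le> C * \<rho> ^ n" "shift x n \<le> C * \<rho> ^ n / \<rho>"
      and D: "D \<ge> 0" "P n + Q / \<rho> \<le> real (Suc n) * \<rho>\<^sup>2 * D\<^sup>2" for x n C D
  proof (rule power2_le_imp_le)
    have x0: "x n \<ge> 0" "shift x n \<ge> 0"
      using x by (cases n; simp add: adm_def)+
    have "real (Suc n) * (x (Suc n))\<^sup>2 \<le> P n * (x n)\<^sup>2 + Q * x n * shift x n"
      using x by (simp add: adm_def)
    also have "\<dots> \<le> P n * (C * \<rho> ^ n)\<^sup>2 + Q * (C * \<rho> ^ n) * (C * \<rho> ^ n / \<rho>)"
      using P Q x0 C \<rho> by (intro add_mono mult_mono power_mono) auto
    also have "\<dots> = (P n + Q / \<rho>) * (C * \<rho> ^ n)\<^sup>2"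
      by (simp add: field_simps power2_eq_square)
    also have "\<dots> \<le> (real (Suc n) * \<rho>\<^sup>2 * D\<^sup>2) * (C * \<rho> ^ n)\<^sup>2"
      using D by (intro mult_right_mono) auto
    also have "\<dots> = real (Suc n) * (D * C * \<rho> ^ Suc n)\<^sup>2"
      by (simp add: power_mult_distrib algebra_simps)
    finally show "(x (Suc n))\<^sup>2 \<le> (D * C * \<rho> ^ Suc n)\<^sup>2"
      by (simp del: of_nat_Suc power_Suc)
    show "0 \<le> D * C * \<rho> ^ Suc n"
      using C D \<rho> by simp
  qed
  have shift: "shift x n \<le> C * \<rho> ^ n / \<rho>" if "\<And>m. m \<le> n \<Longrightarrow> x m \<le> C * \<rho> ^ m" "C > 0" for x C n
    using that \<rho> by (cases n) auto
  have "\<exists>C>0. \<forall>x n. adm x \<longrightarrow> n \<le> M \<longrightarrow> x n \<le> C * \<rho> ^ n" for M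
  proof (induction M)
    case 0
    show ?case
      by (rule exI [of _ "max c 1"]) (auto simp: adm_def intro: max.coboundedI1)
  next
    case (Suc M)
    then obtain C where C: "C > 0" "\<And>x n. adm x \<Longrightarrow> n \<le> M \<Longrightarrow> x n \<le> C * \<rho> ^ n"
      by blast
    \<comment> \<open>The factor by which the constant must grow to survive step \<open>M\<close>;
      at least 1, so that the earlier bounds persist.\<close>
    define D where "D = max 1 (sqrt ((P M + Q / \<rho>) / (real (Suc M) * \<rho>\<^sup>2)))"
    have D: "D \<ge> 1"
      by (simp add: D_def)
    have "(P M + Q / \<rho>) / (real (Suc M) * \<rho>\<^sup>2) \<le> D\<^sup>2"
      unfolding D_def by (rule sqrt_le_D) simp
    then have D': "P M + Q / \<rho> \<le> real (Suc M) * \<rho>\<^sup>2 * D\<^sup>2"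
      using \<rho> by (simp add: divide_le_eq mult_ac del: of_nat_Suc)
    have "x n \<le> D * C * \<rho> ^ n" if "adm x" "n \<le> Suc M" for x n
    proof (cases "n = Suc M")
      case True
      show ?thesis
        unfolding True
        by (rule step [OF that(1) C(1)]) (use C shift D D' that(1) in auto)
    next
      case False
      then have "x n \<le> C * \<rho> ^ n"
        using C that by simp
      also have "\<dots> \<le> D * (C * \<rho> ^ n)"
        using D C \<rho> by simp
      finally show ?thesis
        by (simp add: mult.assoc)
    qed
    moreover have "D * C > 0"
      using C D by simp
    ultimately show ?case
      by blast
  qed
  moreover obtain M where M: "\<And>n. n \<ge> M \<Longrightarrow> P n + Q / \<rho> \<le> real (Suc n) * \<rho>\<^sup>2"
    using ev unfolding eventually_sequentially by blast
  ultimately obtain C where C: "C > 0" "\<And>x n. adm x \<Longrightarrow> n \<le> M \<Longrightarrow> x n \<le> C * \<rho> ^ n"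
    by blast
  have *: "x n \<le> C * \<rho> ^ n" if "adm x" for x n
  proof (induction n rule: less_induct)
    case (less n)
    show ?case
    proof (cases "n \<le> M")
      case True
      then show ?thesis
        using C that by blast
    next
      case False
      then obtain m where m: "n = Suc m" "M \<le> m"
        by (cases n) auto
      \<comment> \<open>Past \<open>M\<close> the constant no longer grows: this is
        \<open>step\<close> with \<open>D\<close> = 1.\<close>
      have "x (Suc m) \<le> 1 * C * \<rho> ^ Suc m"
        by (rule step [OF that C(1)]) (use less m shift C M in auto)
      then show ?thesis
        by (simp add: m)
    qed
  qed
  show ?thesis
    by (rule that [OF C(1)]) (rule *, simp add: adm_def)
qed

context jacobi_lowest_weight
begin

section \<open>Norm estimates from the adjoint relations\<close>

lemma cinner_cre: "u \<in> V \<Longrightarrow> v \<in> V \<Longrightarrow> cinner u (cre v) = cinner (ann u) v"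
  using adj(1) unfolding formal_adjoint_on_def by (metis cinner_commute)

lemma cinner_Kp: "u \<in> V \<Longrightarrow> v \<in> V \<Longrightarrow> cinner u (Kp v) = cinner (Km u) v"
  using adj(3) unfolding formal_adjoint_on_def by (metis cinner_commute)

text \<open>The kernel of the j-th power of \<open>ann\<close> in \<open>V\<close>: vectors with at
  most j - 1 oscillator quanta.\<close>

primrec kernel_ann :: "nat \<Rightarrow> 'h set" where
  "kernel_ann 0 = {0}"
| "kernel_ann (Suc j) = {v \<in> V. ann v \<in> kernel_ann j}"

lemma kernel_ann_add: "u \<in> kernel_ann j \<Longrightarrow> v \<in> kernel_ann j \<Longrightarrow> u + v \<in> kernel_ann j"
  by (induction j arbitrary: u v) auto

lemma kernel_ann_scaleC: "v \<in> kernel_ann j \<Longrightarrow> c *\<^sub>C v \<in> kernel_ann j"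
  by (induction j arbitrary: v) auto

lemma kernel_ann_Suc: "v \<in> kernel_ann j \<Longrightarrow> v \<in> kernel_ann (Suc j)"
  by (induction j arbitrary: v) auto

lemma kernel_ann_cre: "v \<in> kernel_ann j \<Longrightarrow> cre v \<in> kernel_ann (Suc j)"
proof (induction j arbitrary: v)
  case (Suc j)
  then have "cre (ann v) + v \<in> kernel_ann (Suc j)"
    by (intro kernel_ann_add Suc.IH) auto
  then show ?case
    using Suc.prems by (simp add: commute)
qed simp

lemma kernel_ann_Kp: "v \<in> kernel_ann j \<Longrightarrow> Kp v \<in> kernel_ann (Suc (Suc j))"
proof (induction j arbitrary: v)
  case (Suc j)
  then have "Kp (ann v) + cre v \<in> kernel_ann (Suc (Suc j))"
    by (intro kernel_ann_add Suc.IH kernel_ann_cre) auto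
  then show ?case
    using Suc.prems by (simp add: commute)
qed simp

text \<open>The worst case is n factors \<open>Kp\<close>, each of which counts as two creation
  operators because its commutator with \<open>ann\<close> is \<open>cre\<close>.\<close>

lemma coh_kernel_ann: "coh z w n \<in> kernel_ann (2 * n + 1)"
proof (induction n)
  case 0
  then show ?case
    by (simp add: e0_smooth e0_ann)
next
  case (Suc n)
  have "cre (coh z w n) \<in> kernel_ann (Suc (2 * n + 1))"
    "Kp (coh z w n) \<in> kernel_ann (Suc (Suc (2 * n + 1)))"
    using Suc by (rule kernel_ann_cre, rule kernel_ann_Kp)
  then have "coh z w (Suc n) \<in> kernel_ann (Suc (Suc (2 * n + 1)))"
    unfolding coh.simps by (intro kernel_ann_scaleC kernel_ann_add) (rule kernel_ann_Suc)
  then show ?case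
    by simp
qed

text \<open>The squared norms of \<open>cre v\<close> and \<open>ann v\<close> differ by that of
  \<open>v\<close>. The one of \<open>ann v\<close> equals \<open>cinner v (cre (ann v))\<close>,
  and Cauchy-Schwarz with the induction hypothesis for \<open>ann v\<close> bounds it. The result is
  growth of order sqrt n for \<open>cre\<close> on v_n, which is below linear.\<close>

lemma norm_cre_le: "v \<in> kernel_ann j \<Longrightarrow> (norm (cre v))\<^sup>2 \<le> real j * (norm v)\<^sup>2"
proof (induction j arbitrary: v)
  case (Suc j)
  then have v: "v \<in> V" "ann v \<in> kernel_ann j"
    by auto
  have "cinner (cre v) (cre v) = cinner (ann v) (ann v) + cinner v v"
    using v by (simp add: cinner_cre commute cinner_add_left)
      (use adj(1) v in \<open>simp add: formal_adjoint_on_def\<close>)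
  then have 1: "(norm (cre v))\<^sup>2 = (norm (ann v))\<^sup>2 + (norm v)\<^sup>2"
    by (simp only: cinner_self of_real_add [symmetric] of_real_eq_iff)
  have "(norm (ann v))\<^sup>2 = cmod (cinner v (cre (ann v)))"
    using v by (simp add: cinner_cre cinner_self del: of_real_power)
  also have "\<dots> \<le> norm v * norm (cre (ann v))"
    by (rule norm_cinner_le)
  finally have "((norm (ann v))\<^sup>2)\<^sup>2 \<le> (norm v * norm (cre (ann v)))\<^sup>2"
    by (rule power_mono) simp
  also have "\<dots> \<le> (norm v)\<^sup>2 * (real j * (norm (ann v))\<^sup>2)"
    unfolding power_mult_distrib by (intro mult_left_mono Suc.IH v) simp
  finally have "(norm (ann v))\<^sup>2 * (norm (ann v))\<^sup>2 \<le> (real j * (norm v)\<^sup>2) * (norm (ann v))\<^sup>2"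
    by (simp add: power2_eq_square [of "(norm (ann v))\<^sup>2"] mult_ac)
  then have "(norm (ann v))\<^sup>2 \<le> real j * (norm v)\<^sup>2"
    by (cases "ann v = 0") (simp, erule mult_right_le_imp_le, simp)
  then show ?case
    unfolding 1 by (simp add: algebra_simps)
qed simp

lemma norm_cre_coh_le: "norm (cre (coh z w n)) \<le> sqrt (real (2 * n + 1)) * norm (coh z w n)"
  using real_sqrt_le_mono [OF norm_cre_le [OF coh_kernel_ann]]
  by (simp add: real_sqrt_mult)

lemma norm_Kp_le:
  assumes "v \<in> V"
  shows "(norm (Kp v))\<^sup>2 \<le> (norm (Km v))\<^sup>2 + 2 * norm v * norm (K0 v)"
proof -
  have "cinner (Kp v) (Kp v) = cnj (cinner v (Km (Kp v)))"
    using assms by (metis cinner_Kp cinner_commute linear_endo_simps(1) endo(4))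
  also have "\<dots> = cnj (cinner v (Kp (Km v)) + 2 * cinner v (K0 v))"
    using assms by (simp add: commute cinner_right_simps)
  also have "cinner v (Kp (Km v)) = of_real ((norm (Km v))\<^sup>2)"
    using assms by (simp only: cinner_Kp cinner_self operator_simps)
  finally have "Re (cinner (Kp v) (Kp v)) =
      Re (cnj (of_real ((norm (Km v))\<^sup>2) + 2 * cinner v (K0 v)))"
    by (rule arg_cong)
  then have "(norm (Kp v))\<^sup>2 = (norm (Km v))\<^sup>2 + 2 * Re (cinner v (K0 v))"
    by (simp add: cinner_self del: of_real_power)
  also have "Re (cinner v (K0 v)) \<le> norm v * norm (K0 v)"
    using norm_cinner_le complex_Re_le_cmod order_trans by blast
  finally show ?thesis
    by simp
qed

text \<open>One factor B is moved to the other side, where \<open>ann_coh\<close> and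
  \<open>Km_coh'\<close> lower the index. Only the term with |w|^2 n grows linearly, so after
  division by n + 1 the leading coefficient tends to \<open>W\<^sup>2\<close>; the cross term is
  held to order sqrt n by \<open>norm_cre_coh_le\<close>.\<close>

lemma norm_coh_Suc_le:
  assumes "cmod z \<le> Z" "cmod w \<le> W"
  shows "real (Suc n) * (norm (coh z w (Suc n)))\<^sup>2 \<le>
    (Z\<^sup>2 + Z * W * sqrt (2 * n + 1) + W\<^sup>2 * (2 * k + n)) * (norm (coh z w n))\<^sup>2 +
    (W * Z\<^sup>2 / 2) * norm (coh z w n) * shift (\<lambda>n. norm (coh z w n)) n"
proof -
  let ?c = "coh z w n" and ?s = "shift (coh z w) n"
  have ZW: "Z \<ge> 0" "W \<ge> 0"
    using assms norm_ge_zero order_trans by blast+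
  have s: "shift (\<lambda>n. norm (coh z w n)) n = norm ?s"
    by (cases n) simp_all
  have "of_nat (Suc n) * cinner (coh z w (Suc n)) (coh z w (Suc n)) =
      cinner (coh z w (Suc n)) (z *\<^sub>C cre ?c + w *\<^sub>C Kp ?c)"
    unfolding of_nat_Suc_scaleC_coh [symmetric] by (simp only: cinner_right_simps)
  also have "\<dots> = z * cinner (ann (coh z w (Suc n))) ?c + w * cinner (Km (coh z w (Suc n))) ?c"
    by (simp add: cinner_right_simps cinner_cre cinner_Kp del: coh.simps)
  also have "\<dots> = (z * cnj z) * cinner ?c ?c + (z * cnj w) * cinner (cre ?c) ?c +
      (w * cnj w * of_real (2 * k + n)) * cinner ?c ?c + (w * cnj (z\<^sup>2 / 2)) * cinner ?s ?c"
    by (simp add: ann_coh Km_coh' cinner_add_left cinner_scaleC_left algebra_simps del: coh.simps)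
  finally have "cmod (of_nat (Suc n) * cinner (coh z w (Suc n)) (coh z w (Suc n))) = cmod \<dots>"
    by (rule arg_cong)
  also have "\<dots> \<le> cmod ((z * cnj z) * cinner ?c ?c) + cmod ((z * cnj w) * cinner (cre ?c) ?c) +
      cmod ((w * cnj w * of_real (2 * k + n)) * cinner ?c ?c) + cmod ((w * cnj (z\<^sup>2 / 2)) * cinner ?s ?c)"
    by (intro norm_triangle_le add_right_mono order_refl)
  also have "\<dots> \<le> (Z * Z) * (norm ?c)\<^sup>2 + (Z * W) * (sqrt (2 * n + 1) * (norm ?c)\<^sup>2) +
      (W * W * (2 * k + n)) * (norm ?c)\<^sup>2 + (W * (Z\<^sup>2 / 2)) * (norm ?s * norm ?c)"
  proof (intro add_mono)
    have "cmod (cinner (cre ?c) ?c) \<le> norm (cre ?c) * norm ?c"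
      by (rule norm_cinner_le)
    also have "\<dots> \<le> sqrt (2 * n + 1) * norm ?c * norm ?c"
      using norm_cre_coh_le [of z w n] by (intro mult_right_mono) simp_all
    finally have "cmod (cinner (cre ?c) ?c) \<le> sqrt (2 * n + 1) * (norm ?c)\<^sup>2"
      by (simp add: power2_eq_square)
    then show "cmod ((z * cnj w) * cinner (cre ?c) ?c) \<le> (Z * W) * (sqrt (2 * n + 1) * (norm ?c)\<^sup>2)"
      unfolding norm_mult using assms ZW by (intro mult_mono) simp_all
    show "cmod ((w * cnj (z\<^sup>2 / 2)) * cinner ?s ?c) \<le> (W * (Z\<^sup>2 / 2)) * (norm ?s * norm ?c)"
      unfolding norm_mult using assms ZW
      by (intro mult_mono norm_cinner_le) (simp_all add: norm_divide norm_power power_mono)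
    show "cmod ((z * cnj z) * cinner ?c ?c) \<le> (Z * Z) * (norm ?c)\<^sup>2"
      unfolding norm_mult using assms ZW
      by (intro mult_mono) (simp_all add: cinner_self norm_power)
    have "cmod (of_real (2 * k + n)) = 2 * k + n"
      using k_pos by (simp only: norm_of_real)
    then show "cmod ((w * cnj w * of_real (2 * k + n)) * cinner ?c ?c) \<le> (W * W * (2 * k + n)) * (norm ?c)\<^sup>2"
      unfolding norm_mult using assms ZW k_pos
      by (intro mult_mono) (simp_all add: cinner_self norm_power)
  qed
  also have "cmod (of_nat (Suc n) * cinner (coh z w (Suc n)) (coh z w (Suc n))) =
      real (Suc n) * (norm (coh z w (Suc n)))\<^sup>2"
    by (simp only: cinner_self norm_mult norm_of_nat norm_of_real abs_power2)
  finally show ?thesis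
    unfolding s by (simp add: algebra_simps power2_eq_square)
qed

text \<open>The bounds are uniform in \<open>z\<close> and \<open>w\<close>, so that the series may be differentiated along curves.\<close>

lemma coh_bounds:
  assumes W: "0 \<le> W" "W < 1" and Z: "0 \<le> Z"
  shows "\<exists>D \<rho>. 0 < \<rho> \<and> \<rho> < 1 \<and> (\<forall>z w n. cmod z \<le> Z \<longrightarrow> cmod w \<le> W \<longrightarrow>
    norm (coh z w n) \<le> D * (real (Suc n) * \<rho> ^ n) \<and>
    norm (cre (coh z w n)) \<le> D * (real (Suc n) * \<rho> ^ n) \<and>
    norm (Kp (coh z w n)) \<le> D * (real (Suc n) * \<rho> ^ n))"
proof -
  \<comment> \<open>A rate strictly between \<open>W\<close> and 1: above \<open>W\<close> for the
    recursion, below 1 for summability.\<close>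
  define \<rho> where "\<rho> = (W + 1) / 2"
  have \<rho>: "0 < \<rho>" "\<rho> < 1" "W < \<rho>"
    using W by (simp_all add: \<rho>_def)
  define P where "P n = Z\<^sup>2 + Z * W * sqrt (2 * n + 1) + W\<^sup>2 * (2 * k + n)" for n :: nat
  define Q where "Q = W * Z\<^sup>2 / 2"
  have "((\<lambda>n. (P n + Q / \<rho>) / real (Suc n)) \<longlongrightarrow> W\<^sup>2) sequentially"
    unfolding P_def by real_asymp
  moreover have "W\<^sup>2 < \<rho>\<^sup>2"
    using W \<rho> by (intro power_strict_mono) auto
  ultimately have "eventually (\<lambda>n. (P n + Q / \<rho>) / real (Suc n) < \<rho>\<^sup>2) sequentially"
    by (rule order_tendstoD)
  then have ev: "eventually (\<lambda>n. P n + Q / \<rho> \<le> real (Suc n) * \<rho>\<^sup>2) sequentially"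
    by eventually_elim (simp add: divide_less_eq mult_ac del: of_nat_Suc)
  have Q0: "Q \<ge> 0" and P0: "\<And>n. P n \<ge> 0"
    using W Z k_pos by (simp_all add: Q_def P_def)
  obtain C where C: "C > 0" and bound: "\<And>x n. (\<And>n. x n \<ge> 0) \<Longrightarrow> x 0 \<le> norm e0 \<Longrightarrow>
      (\<And>n. real (Suc n) * (x (Suc n))\<^sup>2 \<le> P n * (x n)\<^sup>2 + Q * x n * shift x n) \<Longrightarrow>
      x n \<le> C * \<rho> ^ n"
    using quadratic_recursion_bound [OF \<rho>(1) Q0 P0 ev, of "norm e0"] by blast
  \<comment> \<open>Read off from \<open>norm_Kp_le\<close>: the square bounds the \<open>Km\<close>
    term, the rest bounds twice the product of the norms of v_n and \<open>K0\<close> v_n.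
    \<open>D\<close> then dominates the constants C, 2 C and C sqrt A of the three
    estimates.\<close>
  define A where "A = (W * (2 * k + 1) / \<rho> + Z\<^sup>2 / 2 / \<rho>\<^sup>2)\<^sup>2 + 2 * (k + 1 + Z / \<rho>)"
  define D where "D = C * (2 + sqrt A)"
  have A: "A \<ge> 0"
    using Z \<rho> k_pos by (simp add: A_def)
  have D: "C \<le> D" "2 * C \<le> D" "C * sqrt A \<le> D"
    using C A by (simp_all add: D_def distrib_left add_pos_nonneg)
  have *: "norm (coh z w n) \<le> D * (real (Suc n) * \<rho> ^ n) \<and>
      norm (cre (coh z w n)) \<le> D * (real (Suc n) * \<rho> ^ n) \<and>
      norm (Kp (coh z w n)) \<le> D * (real (Suc n) * \<rho> ^ n)"
    if zw: "cmod z \<le> Z" "cmod w \<le> W" for z w n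
  proof (intro conjI)
    let ?R = "real (Suc n) * (C * \<rho> ^ n)"
    have x: "norm (coh z w n) \<le> C * \<rho> ^ n" for n
      by (rule bound) (use norm_coh_Suc_le [OF zw] in \<open>auto simp: P_def Q_def simp del: coh.simps(2)\<close>)
    \<comment> \<open>Lowering the index costs a factor 1 / \<rho> per step.\<close>
    have s: "norm (shift (coh z w) n) \<le> C * \<rho> ^ n / \<rho>"
      using x [of "n - 1"] \<rho> C by (cases n) simp_all
    have r: "norm (shift (shift (coh z w)) n) \<le> C * \<rho> ^ n / \<rho>\<^sup>2"
      using x [of "n - 2"] \<rho> C by (cases n; cases "n - 1") (simp_all add: power2_eq_square)
    have "C * \<rho> ^ n \<le> ?R"
      using C \<rho> mult_right_mono [of 1 "real (Suc n)" "C * \<rho> ^ n"] by simp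
    then have cR: "norm (coh z w n) \<le> ?R"
      using x [of n] by linarith
    also have "\<dots> \<le> D * (real (Suc n) * \<rho> ^ n)"
      using D \<rho> by (simp add: mult_ac mult_left_mono mult_right_mono)
    finally show "norm (coh z w n) \<le> D * (real (Suc n) * \<rho> ^ n)" .
    have cre: "norm (cre (coh z w n)) \<le> 2 * real (Suc n) * (C * \<rho> ^ n)" for n
    proof -
      have "sqrt (real (2 * n + 1)) \<le> 2 * real (Suc n)"
        by (rule real_le_lsqrt) (simp_all add: power2_eq_square algebra_simps)
      then show ?thesis
        using norm_cre_coh_le [of z w n] x [of n] C \<rho>
        by (meson mult_mono norm_ge_zero of_nat_0_le_iff mult_nonneg_nonneg order_trans zero_le_numeral)
    qed
    have "norm (cre (coh z w n)) \<le> 2 * C * (real (Suc n) * \<rho> ^ n)"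
      using cre [of n] by (simp add: mult_ac)
    also have "\<dots> \<le> D * (real (Suc n) * \<rho> ^ n)"
      using D \<rho> by (intro mult_right_mono) simp_all
    finally show "norm (cre (coh z w n)) \<le> D * (real (Suc n) * \<rho> ^ n)" .
    have cs: "norm (cre (shift (coh z w) n)) \<le> 2 * ?R / \<rho>"
    proof (cases n)
      case (Suc m)
      have "norm (cre (coh z w m)) \<le> 2 * real (Suc m) * (C * \<rho> ^ m)"
        by (rule cre)
      also have "\<dots> \<le> 2 * real (Suc n) * (C * \<rho> ^ m)"
        using Suc C \<rho> by (intro mult_right_mono) simp_all
      also have "\<dots> = 2 * ?R / \<rho>"
        using Suc \<rho> by simp
      finally show ?thesis
        by (simp only: Suc shift.simps)
    qed (use C \<rho> in simp)
    have "norm (Km (coh z w n)) \<le> cmod (w * (2 * of_real k + of_nat n - 1)) * norm (shift (coh z w) n) +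
        cmod (z\<^sup>2 / 2) * norm (shift (shift (coh z w)) n)"
      unfolding Km_coh' norm_scaleC [symmetric] by (rule norm_triangle_ineq)
    also have "\<dots> \<le> (W * (2 * k + 1) * real (Suc n)) * (C * \<rho> ^ n / \<rho>) +
        (Z\<^sup>2 / 2 * real (Suc n)) * (C * \<rho> ^ n / \<rho>\<^sup>2)"
    proof (intro add_mono mult_mono s r)
      have "cmod (2 * of_real k + of_nat n - 1) = \<bar>2 * k + n - 1\<bar>"
        using norm_of_real [of "2 * k + n - 1", where 'a = complex] by simp
      also have "\<dots> \<le> (2 * k + 1) * real (Suc n)"
        using k_pos by (simp add: abs_le_iff algebra_simps)
      finally show "cmod (w * (2 * of_real k + of_nat n - 1)) \<le> W * (2 * k + 1) * real (Suc n)"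
        unfolding norm_mult mult.assoc using zw W by (intro mult_mono) simp_all
      have "cmod (z\<^sup>2 / 2) \<le> Z\<^sup>2 / 2 * 1"
        using zw by (simp add: norm_divide norm_power power_mono)
      also have "\<dots> \<le> Z\<^sup>2 / 2 * real (Suc n)"
        by (intro mult_left_mono) simp_all
      finally show "cmod (z\<^sup>2 / 2) \<le> Z\<^sup>2 / 2 * real (Suc n)" .
    qed (use W Z k_pos in simp_all)
    also have "\<dots> = (W * (2 * k + 1) / \<rho> + Z\<^sup>2 / 2 / \<rho>\<^sup>2) * ?R"
      by (simp add: algebra_simps add_divide_distrib)
    finally have Km: "norm (Km (coh z w n)) \<le> (W * (2 * k + 1) / \<rho> + Z\<^sup>2 / 2 / \<rho>\<^sup>2) * ?R" .
    have "norm (K0 (coh z w n)) \<le> cmod (of_real k + of_nat n) * norm (coh z w n) +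
        cmod (z / 2) * norm (cre (shift (coh z w) n))"
      unfolding K0_coh' norm_scaleC [symmetric] by (rule norm_triangle_ineq4)
    also have "\<dots> \<le> ((k + 1) * real (Suc n)) * (C * \<rho> ^ n) + (Z / 2) * (2 * ?R / \<rho>)"
    proof (intro add_mono mult_mono x cs)
      have "cmod (of_real k + of_nat n) = \<bar>k + n\<bar>"
        using norm_of_real [of "k + n", where 'a = complex] by simp
      also have "\<dots> \<le> (k + 1) * real (Suc n)"
        using k_pos by (simp add: algebra_simps)
      finally show "cmod (of_real k + of_nat n) \<le> (k + 1) * real (Suc n)" .
    qed (use k_pos Z zw in \<open>simp_all add: norm_divide\<close>)
    also have "\<dots> = (k + 1 + Z / \<rho>) * ?R"
      by (simp add: algebra_simps add_divide_distrib)
    finally have K0: "norm (K0 (coh z w n)) \<le> (k + 1 + Z / \<rho>) * ?R" .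
    have "(norm (Kp (coh z w n)))\<^sup>2 \<le> (norm (Km (coh z w n)))\<^sup>2 + 2 * norm (coh z w n) * norm (K0 (coh z w n))"
      by (rule norm_Kp_le) simp
    also have "\<dots> \<le> ((W * (2 * k + 1) / \<rho> + Z\<^sup>2 / 2 / \<rho>\<^sup>2) * ?R)\<^sup>2 + 2 * ?R * ((k + 1 + Z / \<rho>) * ?R)"
      using C \<rho> by (intro add_mono mult_mono power_mono Km K0 cR order_refl) simp_all
    also have "\<dots> = (sqrt A * ?R)\<^sup>2"
    proof -
      have "(X * R)\<^sup>2 + 2 * R * (G * R) = (X\<^sup>2 + 2 * G) * R\<^sup>2" for X R G :: real
        by (simp add: algebra_simps power2_eq_square)
      then show ?thesis
        unfolding power_mult_distrib [of "sqrt A"] real_sqrt_pow2 [OF A] unfolding A_def .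
    qed
    finally have "norm (Kp (coh z w n)) \<le> sqrt A * ?R"
      by (rule power2_le_imp_le) (use A C \<rho> in simp)
    also have "\<dots> = C * sqrt A * (real (Suc n) * \<rho> ^ n)"
      by (simp only: mult_ac)
    also have "\<dots> \<le> D * (real (Suc n) * \<rho> ^ n)"
      using D \<rho> by (intro mult_right_mono) simp_all
    finally show "norm (Kp (coh z w n)) \<le> D * (real (Suc n) * \<rho> ^ n)" .
  qed
  show ?thesis
    by (rule exI [of _ D], rule exI [of _ \<rho>], intro conjI allI impI \<rho>) (simp_all add: * del: of_nat_Suc)
qed

end

section \<open>One-parameter groups acting on coherent states\<close>

context jacobi_lowest_weight
begin

abbreviation e :: "complex \<Rightarrow> complex \<Rightarrow> 'h" where
  "e z w \<equiv> coherent cre Kp e0 z w"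

lemma coh_sums:
  assumes "cmod w < 1"
  shows "coh z w sums e z w"
proof -
  obtain D \<rho> where \<rho>: "0 < \<rho>" "\<rho> < 1"
    and D: "\<forall>z' w' n. cmod z' \<le> cmod z \<longrightarrow> cmod w' \<le> cmod w \<longrightarrow>
      norm (coh z' w' n) \<le> D * (real (Suc n) * \<rho> ^ n) \<and>
      norm (cre (coh z' w' n)) \<le> D * (real (Suc n) * \<rho> ^ n) \<and>
      norm (Kp (coh z' w' n)) \<le> D * (real (Suc n) * \<rho> ^ n)"
    using coh_bounds [OF norm_ge_zero assms norm_ge_zero [of z]] by (elim exE conjE) (rule that)
  have "summable (\<lambda>n. D * (real (Suc n) * \<rho> ^ n))"
    using geometric_deriv_sums [of \<rho>] \<rho> by (intro summable_mult) (simp add: sums_iff)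
  then have "summable (\<lambda>n. norm (coh z w n))"
    by (rule summable_comparison_test' [where N = 0]) (simp add: D del: of_nat_Suc)
  then show ?thesis
    unfolding coherent_eq by (rule summable_sums [OF summable_norm_cancel_complete])
qed

lemma e_zero: "e 0 0 = e0"
proof -
  have "coh 0 0 = (\<lambda>n. if n = 0 then e0 else 0)"
  proof
    show "coh 0 0 n = (if n = 0 then e0 else 0)" for n
      by (cases n) simp_all
  qed
  then have "coh 0 0 sums e0"
    using sums_single [of 0 "\<lambda>_. e0"] by simp
  then show ?thesis
    using coh_sums [of 0 0] by (simp add: sums_unique2)
qed

lemma V_dense_eqI:
  assumes "\<And>u. u \<in> V \<Longrightarrow> inner u x = inner u y"
  shows "x = y"
proof -
  have "x - y \<in> closure V"
    using dense by simp
  moreover have "closed {u. inner u (x - y) = 0}"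
    by (intro closed_Collect_eq continuous_intros)
  with assms have "closure V \<subseteq> {u. inner u (x - y) = 0}"
    by (intro closure_minimal) (auto simp: inner_diff_right)
  ultimately have "inner (x - y) (x - y) = 0"
    by blast
  then show ?thesis
    by simp
qed

section \<open>The flow equation and its truncation error\<close>

definition lie_op :: "real \<Rightarrow> complex \<Rightarrow> real \<Rightarrow> complex \<Rightarrow> 'h \<Rightarrow> 'h" where
  "lie_op s x \<theta> y v = (\<i> * of_real s) *\<^sub>C v + x *\<^sub>C cre v - cnj x *\<^sub>C ann v +
     (2 * \<i> * of_real \<theta>) *\<^sub>C K0 v + y *\<^sub>C Kp v - cnj y *\<^sub>C Km v"

text \<open>The amount by which the partial sums of a moving coherent state fail to satisfy the flow equation
  with generator \<open>lie_op\<close>.\<close>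

definition remainder :: "complex \<Rightarrow> complex \<Rightarrow> complex \<Rightarrow> complex \<Rightarrow> nat \<Rightarrow> 'h" where
  "remainder x y z w n =
    (cnj x * z + 2 * of_real k * cnj y * w + cnj y * z\<^sup>2 / 2) *\<^sub>C shift (coh z w) n +
    (cnj y * z\<^sup>2 / 2) *\<^sub>C shift (shift (coh z w)) n +
    x *\<^sub>C cre (shift (coh z w) n) + y *\<^sub>C Kp (shift (coh z w) n) +
    (cnj y * z * w) *\<^sub>C cre (shift (shift (coh z w)) n) +
    (cnj y * w\<^sup>2) *\<^sub>C Kp (shift (shift (coh z w)) n)"

text \<open>The three equations are the flow of the vector field, so the defect of the whole series
  vanishes formally; term by term, equal expressions meet at different indices. An index gap of one
  is a difference by itself. The z^2 / 2 part of \<open>Km\<close> has gap two and is split as (v_n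
  - v_{n-1}) + (v_{n-1} - v_{n-2}), which is why this coefficient occurs twice in
  \<open>remainder\<close>.\<close>

lemma remainder_diff:
  assumes z': "z' = x - cnj x * w + \<i> * of_real \<theta> * z - cnj y * z * w"
    and w': "w' = 2 * \<i> * of_real \<theta> * w + y - cnj y * w\<^sup>2"
    and l': "l' = \<i> * of_real s - cnj x * z + 2 * \<i> * of_real \<theta> * of_real k -
      cnj y * (2 * of_real k * w + z\<^sup>2 / 2)"
  shows "z' *\<^sub>C cre (shift (coh z w) n) + w' *\<^sub>C Kp (shift (coh z w) n) + l' *\<^sub>C coh z w n -
    lie_op s x \<theta> y (coh z w n) = - (remainder x y z w (Suc n) - remainder x y z w n)"
  by (rule cinner_eqI)
    (simp add: lie_op_def remainder_def ann_coh K0_coh Km_coh z' w' l' cinner_right_simps,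
      simp add: algebra_simps power2_eq_square)

lemma lie_op_scaleC: "v \<in> V \<Longrightarrow> lie_op s x \<theta> y (c *\<^sub>C v) = c *\<^sub>C lie_op s x \<theta> y v"
  by (rule cinner_eqI) (simp add: lie_op_def cinner_right_simps algebra_simps)

text \<open>One null sequence has to serve all z and w met along a curve. The index
  \<open>Suc (Suc n)\<close> unfolds both shifts without case distinctions.\<close>

lemma remainder_bound:
  assumes "0 \<le> W" "W < 1" "0 \<le> Z"
  shows "\<exists>b. b \<longlonglongrightarrow> 0 \<and> (\<forall>z w n. cmod z \<le> Z \<longrightarrow> cmod w \<le> W \<longrightarrow>
    norm (remainder x y z w (Suc (Suc n))) \<le> b n)"
proof -
  obtain D \<rho> where \<rho>: "0 < \<rho>" "\<rho> < 1" and D: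
    "\<forall>z w n. cmod z \<le> Z \<longrightarrow> cmod w \<le> W \<longrightarrow>
      norm (coh z w n) \<le> D * (real (Suc n) * \<rho> ^ n) \<and>
      norm (cre (coh z w n)) \<le> D * (real (Suc n) * \<rho> ^ n) \<and>
      norm (Kp (coh z w n)) \<le> D * (real (Suc n) * \<rho> ^ n)"
    using coh_bounds [OF assms] by (elim exE conjE) (rule that)
  define B where "B n = D * (real (Suc n) * \<rho> ^ n)" for n
  define b where "b n = (cmod x * Z + 2 * k * cmod y * W + cmod y * Z\<^sup>2 / 2) * B (Suc n) +
      (cmod y * Z\<^sup>2 / 2) * B n + cmod x * B (Suc n) + cmod y * B (Suc n) +
      (cmod y * Z * W) * B n + (cmod y * W\<^sup>2) * B n" for n
  have summable: "summable B"
    unfolding B_def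
    using geometric_deriv_sums [of \<rho>] \<rho> by (intro summable_mult) (simp add: sums_iff)
  have B: "B \<longlonglongrightarrow> 0" "(\<lambda>n. B (Suc n)) \<longlonglongrightarrow> 0"
    using summable_LIMSEQ_zero [OF summable] by (simp_all add: LIMSEQ_Suc)
  have "b \<longlonglongrightarrow> (cmod x * Z + 2 * k * cmod y * W + cmod y * Z\<^sup>2 / 2) * 0 +
      (cmod y * Z\<^sup>2 / 2) * 0 + cmod x * 0 + cmod y * 0 + (cmod y * Z * W) * 0 + (cmod y * W\<^sup>2) * 0"
    unfolding b_def [abs_def] by (intro tendsto_add tendsto_mult_left B)
  then have "b \<longlonglongrightarrow> 0"
    by simp
  moreover have "norm (remainder x y z w (Suc (Suc n))) \<le> b n"
    if zw: "cmod z \<le> Z" "cmod w \<le> W" for z w n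
  proof -
    have bounds: "norm (coh z w i) \<le> B i" "norm (cre (coh z w i)) \<le> B i" "norm (Kp (coh z w i)) \<le> B i" for i
      using D [rule_format, OF zw, of i] by (simp_all only: B_def)
    have B0: "0 \<le> B i" for i
      using bounds(1) [of i] norm_ge_zero order_trans by blast
    have "norm (remainder x y z w (Suc (Suc n))) \<le>
      norm ((cnj x * z + 2 * of_real k * cnj y * w + cnj y * z\<^sup>2 / 2) *\<^sub>C coh z w (Suc n)) +
      norm ((cnj y * z\<^sup>2 / 2) *\<^sub>C coh z w n) +
      norm (x *\<^sub>C cre (coh z w (Suc n))) + norm (y *\<^sub>C Kp (coh z w (Suc n))) +
      norm ((cnj y * z * w) *\<^sub>C cre (coh z w n)) +
      norm ((cnj y * w\<^sup>2) *\<^sub>C Kp (coh z w n))"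
      unfolding remainder_def shift.simps by (intro norm_triangle_le add_right_mono order_refl)
    also have "\<dots> \<le> b n"
      unfolding b_def norm_scaleC
    proof (intro add_mono mult_mono)
      have "cmod (cnj x * z + 2 * of_real k * cnj y * w + cnj y * z\<^sup>2 / 2) \<le>
          cmod (cnj x * z) + cmod (2 * of_real k * cnj y * w) + cmod (cnj y * z\<^sup>2 / 2)"
        by (intro norm_triangle_le add_right_mono order_refl)
      also have "\<dots> \<le> cmod x * Z + 2 * k * cmod y * W + cmod y * Z\<^sup>2 / 2"
        unfolding norm_mult norm_divide norm_power using zw assms k_pos
        by (intro add_mono mult_mono divide_right_mono power_mono) (simp_all add: mult_left_mono power_mono)
      finally show "cmod (cnj x * z + 2 * of_real k * cnj y * w + cnj y * z\<^sup>2 / 2) \<le>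
        cmod x * Z + 2 * k * cmod y * W + cmod y * Z\<^sup>2 / 2" .
      have "cmod y * (cmod z)\<^sup>2 \<le> cmod y * Z\<^sup>2"
        using zw by (intro mult_left_mono power_mono) simp_all
      then show "cmod (cnj y * z\<^sup>2 / 2) \<le> cmod y * Z\<^sup>2 / 2"
        by (simp add: norm_mult norm_divide norm_power)
      show "cmod (cnj y * z * w) \<le> cmod y * Z * W"
        unfolding norm_mult using zw assms by (intro mult_mono) simp_all
      show "cmod (cnj y * w\<^sup>2) \<le> cmod y * W\<^sup>2"
        unfolding norm_mult norm_power using zw assms by (intro mult_mono power_mono) simp_all
    qed (use assms k_pos in \<open>simp_all add: bounds B0 del: coh.simps\<close>)
    finally show ?thesis .
  qed
  ultimately show ?thesis
    by (intro exI [of _ b]) simp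
qed

text \<open>Testing against smooth vectors \<open>u\<close>, the function \<open>t \<mapsto> inner (U t u) (l t *\<^sub>C e (z t) (w t))\<close> is
  constant, since the derivatives of the truncated series telescope to a vanishing remainder.\<close>

lemma unitary_group_coherent:
  fixes z w l :: "real \<Rightarrow> complex"
  assumes U: "unitary_group U"
    and gen: "\<And>v. v \<in> V \<Longrightarrow> ((\<lambda>t. U t v) has_vector_derivative lie_op s x \<theta> y v) (at 0)"
    and dz: "\<And>t. (z has_vector_derivative
      x - cnj x * w t + \<i> * of_real \<theta> * z t - cnj y * z t * w t) (at t)"
    and dw: "\<And>t. (w has_vector_derivative 2 * \<i> * of_real \<theta> * w t + y - cnj y * (w t)\<^sup>2) (at t)"
    and dl: "\<And>t. (l has_vector_derivative l t * (\<i> * of_real s - cnj x * z t +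
      2 * \<i> * of_real \<theta> * of_real k - cnj y * (2 * of_real k * w t + (z t)\<^sup>2 / 2))) (at t)"
    and w: "\<And>t. cmod (w t) < 1" and l0: "l 0 = 1"
  shows "U t (e (z 0) (w 0)) = l t *\<^sub>C e (z t) (w t)"
proof -
  \<comment> \<open>A symmetric interval covers both signs of \<open>t\<close>. By compactness z, w
    and l are bounded on it by attained values, so the bound for w stays strictly below 1.\<close>
  define S where "S = {- \<bar>t\<bar>..\<bar>t\<bar>}"
  have S: "compact S" "S \<noteq> {}" "convex S" "0 \<in> S" "t \<in> S"
    by (auto simp: S_def)
  have cont: "continuous_on S z" "continuous_on S w" "continuous_on S l"
    using dz dw dl by (meson continuous_at_imp_continuous_on has_vector_derivative_continuous)+
  obtain t1 where t1: "\<And>r. r \<in> S \<Longrightarrow> cmod (z r) \<le> cmod (z t1)"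
    using continuous_attains_sup [OF S(1,2) continuous_on_norm [OF cont(1)]] by blast
  obtain t2 where t2: "\<And>r. r \<in> S \<Longrightarrow> cmod (w r) \<le> cmod (w t2)"
    using continuous_attains_sup [OF S(1,2) continuous_on_norm [OF cont(2)]] by blast
  obtain t3 where t3: "\<And>r. r \<in> S \<Longrightarrow> cmod (l r) \<le> cmod (l t3)"
    using continuous_attains_sup [OF S(1,2) continuous_on_norm [OF cont(3)]] by blast
  obtain b where b: "b \<longlonglongrightarrow> 0"
    "\<forall>p q n. cmod p \<le> cmod (z t1) \<longrightarrow> cmod q \<le> cmod (w t2) \<longrightarrow>
      norm (remainder x y p q (Suc (Suc n))) \<le> b n"
    using remainder_bound [OF norm_ge_zero w [of t2] norm_ge_zero [of "z t1"], of x y] by (elim exE conjE) (rule that)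
  have const: "inner (U t u) (l t *\<^sub>C e (z t) (w t)) = inner u (e (z 0) (w 0))" if u: "u \<in> V" for u
  proof -
    define f where "f n r = inner (U r u) (\<Sum>i<n. l r *\<^sub>C coh (z r) (w r) i)" for n r
    define f' where "f' n r = inner (U r u) (- (l r *\<^sub>C remainder x y (z r) (w r) n))" for n r
    have deriv: "(f n has_vector_derivative f' n r) (at r)" for n r
    proof -
      let ?z' = "x - cnj x * w r + \<i> * of_real \<theta> * z r - cnj y * z r * w r"
      let ?w' = "2 * \<i> * of_real \<theta> * w r + y - cnj y * (w r)\<^sup>2"
      let ?l' = "\<i> * of_real s - cnj x * z r + 2 * \<i> * of_real \<theta> * of_real k -
          cnj y * (2 * of_real k * w r + (z r)\<^sup>2 / 2)"
      let ?d = "\<lambda>i. ?z' *\<^sub>C cre (shift (coh (z r) (w r)) i) + ?w' *\<^sub>C Kp (shift (coh (z r) (w r)) i)"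
      let ?R = "remainder x y (z r) (w r)"
      have 1: "((\<lambda>r. inner (U r u) (l r *\<^sub>C coh (z r) (w r) i)) has_vector_derivative
          inner (U r u) (- (l r *\<^sub>C (?R (Suc i) - ?R i)))) (at r)" for i
      proof -
        have endo: "linear_endo_on V (\<lambda>v. v)"
          by (simp add: linear_endo_on_def)
        have "((\<lambda>r. inner (U r u) (l r *\<^sub>C coh (z r) (w r) i)) has_vector_derivative
            inner (U r u) (l r *\<^sub>C ?d i + (l r * ?l') *\<^sub>C coh (z r) (w r) i) +
            inner (U r (lie_op s x \<theta> y u)) (l r *\<^sub>C coh (z r) (w r) i)) (at r)"
          by (intro bounded_bilinear.has_vector_derivative [OF bounded_bilinear_inner]
              unitary_group_derivative [OF U] gen u has_vector_derivative_scaleC dl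
              coh_has_vector_derivative [OF dz dw endo])
        \<comment> \<open>The generator passes from the test vector to a single term of the series;
          both are smooth.\<close>
        also have "inner (U r (lie_op s x \<theta> y u)) (l r *\<^sub>C coh (z r) (w r) i) =
            - inner (U r u) (lie_op s x \<theta> y (l r *\<^sub>C coh (z r) (w r) i))"
          by (rule unitary_group_skew [OF U gen gen]) (simp_all add: u)
        also have "inner (U r u) (l r *\<^sub>C ?d i + (l r * ?l') *\<^sub>C coh (z r) (w r) i) +
            - inner (U r u) (lie_op s x \<theta> y (l r *\<^sub>C coh (z r) (w r) i)) =
          inner (U r u) (l r *\<^sub>C (?d i + ?l' *\<^sub>C coh (z r) (w r) i - lie_op s x \<theta> y (coh (z r) (w r) i)))"
          by (simp add: lie_op_scaleC scaleC_diff_right scaleC_add_right scaleC_scaleC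
              inner_add_right inner_diff_right)
        also have "?d i + ?l' *\<^sub>C coh (z r) (w r) i - lie_op s x \<theta> y (coh (z r) (w r) i) =
            - (?R (Suc i) - ?R i)"
          by (rule remainder_diff) (rule refl)+
        finally show ?thesis
          by (simp only: scaleC_minus_right)
      qed
      have "((\<lambda>r. \<Sum>i<n. inner (U r u) (l r *\<^sub>C coh (z r) (w r) i)) has_vector_derivative
          (\<Sum>i<n. inner (U r u) (- (l r *\<^sub>C (?R (Suc i) - ?R i))))) (at r)"
        by (intro has_vector_derivative_sum 1)
      moreover have "(\<Sum>i<n. inner (U r u) (- (l r *\<^sub>C (?R (Suc i) - ?R i)))) = f' n r"
      proof -
        have "(\<Sum>i<n. inner (U r u) (- (l r *\<^sub>C (?R (Suc i) - ?R i)))) =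
            (\<Sum>i<n. (- inner (U r u) (l r *\<^sub>C ?R (Suc i))) - (- inner (U r u) (l r *\<^sub>C ?R i)))"
          by (simp add: scaleC_diff_right inner_diff_right)
        \<comment> \<open>The lower boundary term is zero because both shifts vanish at index
          0.\<close>
        also have "\<dots> = f' n r"
          by (subst sum_lessThan_telescope) (simp add: f'_def remainder_def)
        finally show ?thesis .
      qed
      ultimately show ?thesis
        by (simp add: f_def [abs_def] inner_sum_right)
    qed
    \<comment> \<open>Mean value inequality on \<open>S\<close>. The bound tends to 0 with n, so the
      limit of \<open>f n\<close> takes the same value at \<open>t\<close> and at 0.\<close>
    have bound: "norm (f (Suc (Suc n)) t - f (Suc (Suc n)) 0) \<le> norm u * (cmod (l t3) * b n) * norm (t - 0)" for n
    proof (rule field_differentiable_bound [OF S(3) _ _ S(5,4)])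
      fix r assume r: "r \<in> S"
      show "(f (Suc (Suc n)) has_field_derivative f' (Suc (Suc n)) r) (at r within S)"
        using deriv by (simp add: has_real_derivative_iff_has_vector_derivative
            has_vector_derivative_at_within)
      have "norm (f' (Suc (Suc n)) r) \<le> norm (U r u) * (cmod (l r) * norm (remainder x y (z r) (w r) (Suc (Suc n))))"
        using Cauchy_Schwarz_ineq2 [of "U r u" "- (l r *\<^sub>C remainder x y (z r) (w r) (Suc (Suc n)))"]
        by (simp add: f'_def norm_scaleC)
      also have "norm (U r u) = norm u"
        by (simp add: unitary_op_norm unitary_group_op [OF U])
      also have "norm u * (cmod (l r) * norm (remainder x y (z r) (w r) (Suc (Suc n)))) \<le>
          norm u * (cmod (l t3) * b n)"
        using t1 t2 t3 b(2) r by (intro mult_left_mono mult_mono) simp_all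
      finally show "norm (f' (Suc (Suc n)) r) \<le> norm u * (cmod (l t3) * b n)" .
    qed
    have "(\<lambda>n. norm u * (cmod (l t3) * b n) * norm (t - 0)) \<longlonglongrightarrow>
        norm u * (cmod (l t3) * 0) * norm (t - 0)"
      by (intro tendsto_mult_left tendsto_mult_right b(1))
    then have null: "(\<lambda>n. norm u * (cmod (l t3) * b n) * norm (t - 0)) \<longlonglongrightarrow> 0"
      by simp
    have lim: "(\<lambda>n. f n r) \<longlonglongrightarrow> inner (U r u) (l r *\<^sub>C e (z r) (w r))" for r
    proof -
      have "(\<lambda>i. l r *\<^sub>C coh (z r) (w r) i) sums (l r *\<^sub>C e (z r) (w r))"
        by (rule bounded_linear.sums [OF bounded_linear_scaleC_right coh_sums [OF w]])
      then show ?thesis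
        unfolding f_def sums_def by (rule tendsto_inner [OF tendsto_const])
    qed
    have lim_Suc: "(\<lambda>n. f (Suc (Suc n)) r) \<longlonglongrightarrow> inner (U r u) (l r *\<^sub>C e (z r) (w r))" for r
      by (rule LIMSEQ_Suc [OF LIMSEQ_Suc [OF lim]])
    have "(\<lambda>n. f (Suc (Suc n)) t - f (Suc (Suc n)) 0) \<longlonglongrightarrow> 0"
      by (rule Lim_null_comparison [OF always_eventually [OF allI [OF bound]] null])
    from LIMSEQ_unique [OF tendsto_diff [OF lim_Suc [of t] lim_Suc [of 0]] this]
    have "inner (U t u) (l t *\<^sub>C e (z t) (w t)) = inner (U 0 u) (l 0 *\<^sub>C e (z 0) (w 0))"
      by (simp only: right_minus_eq)
    then show ?thesis
      by (simp add: l0 unitary_group_zero [OF U])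
  qed
  \<comment> \<open>Once \<open>U t\<close> is moved off the smooth vector, density applies, and no
    derivative of the orbit of \<open>e z w\<close> itself is taken.\<close>
  have "e (z 0) (w 0) = U (- t) (l t *\<^sub>C e (z t) (w t))"
  proof (rule V_dense_eqI)
    fix u assume "u \<in> V"
    from const [OF this] show "inner u (e (z 0) (w 0)) = inner u (U (- t) (l t *\<^sub>C e (z t) (w t)))"
      unfolding unitary_group_inner [OF U] by (rule sym)
  qed
  then have "U t (e (z 0) (w 0)) = U t (U (- t) (l t *\<^sub>C e (z t) (w t)))"
    by (rule arg_cong)
  also have "\<dots> = U (t + - t) (l t *\<^sub>C e (z t) (w t))"
    by (rule unitary_group_add [OF U, symmetric])
  also have "\<dots> = l t *\<^sub>C e (z t) (w t)"
    by (simp add: unitary_group_zero [OF U])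
  finally show ?thesis .
qed

end

section \<open>One-parameter subgroups of \<open>SU(1,1)\<close>\<close>

lemma mat2_nth [simp]:
  "mat2 p q r s $ 1 $ 1 = p" "mat2 p q r s $ 1 $ 2 = q"
  "mat2 p q r s $ 2 $ 1 = r" "mat2 p q r s $ 2 $ 2 = s"
  by (simp_all add: mat2_def)

lemma mat2_eqI:
  fixes A B :: "complex^2^2"
  assumes "A $ 1 $ 1 = B $ 1 $ 1" "A $ 1 $ 2 = B $ 1 $ 2" "A $ 2 $ 1 = B $ 2 $ 1" "A $ 2 $ 2 = B $ 2 $ 2"
  shows "A = B"
  using assms by (simp add: vec_eq_iff forall_2)

lemma mat_1_eq_mat2: "mat 1 = mat2 1 0 0 1"
  by (rule mat2_eqI) (simp_all add: mat_def)

lemma mat2_mult: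
  "mat2 p q r s ** mat2 p' q' r' s' =
    mat2 (p * p' + q * r') (p * q' + q * s') (r * p' + s * r') (r * q' + s * s')"
  by (rule mat2_eqI) (simp_all add: matrix_matrix_mult_def sum_2)

lemma scaleR_mat2: "t *\<^sub>R mat2 p q r s = mat2 (t * p) (t * q) (t * r) (t * s)"
  by (rule mat2_eqI) (simp_all add: scaleR_conv_of_real [where 'a = complex])

lemma continuous_on_mat2:
  assumes "continuous_on S p" "continuous_on S q" "continuous_on S r" "continuous_on S s"
  shows "continuous_on S (\<lambda>t. mat2 (p t) (q t) (r t) (s t))"
proof -
  have *: "mat2 p q r s = (\<chi> i j. if i = 1 then if j = 1 then p else q else if j = 1 then r else s)"
    for p q r s
    by (rule mat2_eqI) simp_all
  have "continuous_on S (\<lambda>t. if i = 1 then if j = 1 then p t else q t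
      else if j = 1 then r t else s t)" for i j :: 2
    using assms by (cases "i = 1"; cases "j = 1") simp_all
  then show ?thesis
    unfolding * by (intro continuous_on_vec_lambda)
qed

lemma sums_mat2:
  assumes "p sums p'" "q sums q'" "r sums r'" "s sums s'"
  shows "(\<lambda>n. mat2 (p n) (q n) (r n) (s n)) sums mat2 p' q' r' s'"
  unfolding sums_def
proof (rule vec_tendstoI, rule vec_tendstoI)
  fix i j :: 2
  show "(\<lambda>n. (\<Sum>m<n. mat2 (p m) (q m) (r m) (s m)) $ i $ j) \<longlonglongrightarrow> mat2 p' q' r' s' $ i $ j"
    using assms exhaust_2 [of i] exhaust_2 [of j] by (auto simp: sums_def)
qed

text \<open>A trace-free matrix squares to the scalar \<open>p\<^sup>2 + q r = m\<^sup>2\<close>.\<close>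

lemma mat_exp_trace_free:
  assumes m: "p\<^sup>2 + q * r = m\<^sup>2" "m \<noteq> 0"
  defines "C t \<equiv> (exp (of_real t * m) + exp (- (of_real t * m))) / 2"
    and "S t \<equiv> (exp (of_real t * m) - exp (- (of_real t * m))) / (2 * m)"
  shows "mat_exp (t *\<^sub>R mat2 p q r (- p)) = mat2 (C t + p * S t) (q * S t) (r * S t) (C t - p * S t)"
proof -
  \<comment> \<open>By Cayley-Hamilton the n-th power of the matrix X is \<open>c n\<close> times
    the identity plus \<open>s n\<close> times X. The exponential series of these coefficients give
    cosh(tm) and sinh(tm)/m.\<close>
  define c where "c n = (m ^ n + (- m) ^ n) / 2" for n
  define s where "s n = (m ^ n - (- m) ^ n) / (2 * m)" for n
  have cs: "c (Suc n) = m\<^sup>2 * s n" "s (Suc n) = c n" for n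
    using m(2) by (simp_all add: c_def s_def field_simps power2_eq_square)
  have power: "((\<lambda>M. t *\<^sub>R mat2 p q r (- p) ** M) ^^ n) (mat 1) =
      t ^ n *\<^sub>R mat2 (c n + p * s n) (q * s n) (r * s n) (c n - p * s n)" for n
  proof (induction n)
    case 0
    then show ?case
      by (simp add: mat_1_eq_mat2 c_def s_def)
  next
    case (Suc n)
    have "((\<lambda>M. t *\<^sub>R mat2 p q r (- p) ** M) ^^ Suc n) (mat 1) =
        t *\<^sub>R mat2 p q r (- p) ** (t ^ n *\<^sub>R mat2 (c n + p * s n) (q * s n) (r * s n) (c n - p * s n))"
      by (simp add: Suc)
    also have "\<dots> = t ^ Suc n *\<^sub>R mat2 (c (Suc n) + p * s (Suc n)) (q * s (Suc n)) (r * s (Suc n))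
        (c (Suc n) - p * s (Suc n))"
      unfolding scaleR_mat2 mat2_mult cs m(1) [symmetric]
      by (rule mat2_eqI) (simp_all add: algebra_simps power2_eq_square)
    finally show ?case .
  qed
  have exps: "(\<lambda>n. t ^ n * m ^ n / fact n) sums exp (of_real t * m)"
    "(\<lambda>n. t ^ n * (- m) ^ n / fact n) sums exp (of_real t * (- m))"
    using exp_converges [of "of_real t * m"] exp_converges [of "of_real t * (- m)"]
    by (simp_all only: scaleR_conv_of_real power_mult_distrib divide_inverse of_real_inverse
        of_real_fact of_real_power mult_ac)
  have C: "(\<lambda>n. t ^ n * c n / fact n) sums C t"
    using sums_mult [OF sums_add [OF exps], of "1 / 2"]
    by (simp add: c_def C_def field_simps)
  have S: "(\<lambda>n. t ^ n * s n / fact n) sums S t"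
    using sums_mult [OF sums_diff [OF exps], of "1 / (2 * m)"]
    by (simp add: s_def S_def field_simps)
  have "(\<lambda>n. mat2 (t ^ n * c n / fact n + p * (t ^ n * s n / fact n)) (q * (t ^ n * s n / fact n))
      (r * (t ^ n * s n / fact n)) (t ^ n * c n / fact n - p * (t ^ n * s n / fact n)))
    sums mat2 (C t + p * S t) (q * S t) (r * S t) (C t - p * S t)"
    by (intro sums_mat2 sums_add sums_diff sums_mult C S)
  moreover have "mat2 (t ^ n * c n / fact n + p * (t ^ n * s n / fact n)) (q * (t ^ n * s n / fact n))
      (r * (t ^ n * s n / fact n)) (t ^ n * c n / fact n - p * (t ^ n * s n / fact n)) =
      (1 / fact n) *\<^sub>R ((\<lambda>M. t *\<^sub>R mat2 p q r (- p) ** M) ^^ n) (mat 1)" for n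
    unfolding power unfolding scaleR_mat2 by (rule mat2_eqI) (simp_all add: field_simps)
  ultimately show ?thesis
    by (simp add: mat_exp_def sums_iff)
qed

lemma mat_exp_rotation: "mat_exp (t *\<^sub>R su11 1 0) = mat2 (cis t) 0 0 (cis (- t))"
proof -
  have "su11 1 0 = mat2 \<i> 0 0 (- \<i>)"
    by (simp add: su11_def)
  then show ?thesis
    using mat_exp_trace_free [of \<i> 0 0 \<i> t]
    by (simp, intro mat2_eqI) (simp_all add: cis_conv_exp field_simps)
qed

abbreviation boost :: "complex \<Rightarrow> real \<Rightarrow> complex^2^2" where
  "boost y t \<equiv> mat2 (of_real (cosh t)) (y * of_real (sinh t)) (cnj y * of_real (sinh t)) (of_real (cosh t))"

lemma mat_exp_hyperbolic:
  assumes "cmod y = 1"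
  shows "mat_exp (t *\<^sub>R su11 0 y) = boost y t"
proof -
  have "y * cnj y = 1"
    using complex_norm_square [of y] assms by simp
  then have "mat_exp (t *\<^sub>R su11 0 y) =
      mat2 ((exp (of_real t) + exp (- of_real t)) / 2) (y * ((exp (of_real t) - exp (- of_real t)) / 2))
        (cnj y * ((exp (of_real t) - exp (- of_real t)) / 2)) ((exp (of_real t) + exp (- of_real t)) / 2)"
    using mat_exp_trace_free [of 0 y "cnj y" 1 t] by (simp add: su11_def)
  also have "\<dots> = boost y t"
    by (simp add: cosh_field_def sinh_field_def exp_of_real flip: of_real_minus)
  finally show ?thesis .
qed

lemma SU11_mat2: "(cmod a)\<^sup>2 - (cmod b)\<^sup>2 = 1 \<Longrightarrow> mat2 a b (cnj b) (cnj a) \<in> SU11"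
  unfolding SU11_def by blast

section \<open>The fractional linear action on the unit disc\<close>

lemma denominator_SU11:
  assumes "(cmod a)\<^sup>2 - (cmod b)\<^sup>2 = 1" "cmod w < 1"
  shows "cnj b * w + cnj a \<noteq> 0"
proof
  assume "cnj b * w + cnj a = 0"
  then have "cmod a = cmod b * cmod w"
    by (metis add.commute add_eq_0_iff complex_mod_cnj norm_minus_cancel norm_mult)
  also have "\<dots> \<le> cmod b"
    using assms by (simp add: mult_left_le)
  finally have "(cmod a)\<^sup>2 \<le> (cmod b)\<^sup>2"
    by (rule power_mono) simp
  then show False
    using assms(1) by linarith
qed

lemma norm_SU11_act_less:
  assumes ab: "(cmod a)\<^sup>2 - (cmod b)\<^sup>2 = 1" and w: "cmod w < 1"
  shows "cmod ((a * w + b) / (cnj b * w + cnj a)) < 1"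
proof -
  have "complex_of_real ((cmod (cnj b * w + cnj a))\<^sup>2 - (cmod (a * w + b))\<^sup>2) =
      complex_of_real (((cmod a)\<^sup>2 - (cmod b)\<^sup>2) * (1 - (cmod w)\<^sup>2))"
    by (simp only: of_real_diff of_real_mult complex_norm_square of_real_1) (simp add: algebra_simps)
  then have "(cmod (cnj b * w + cnj a))\<^sup>2 - (cmod (a * w + b))\<^sup>2 = 1 - (cmod w)\<^sup>2"
    by (simp only: of_real_eq_iff ab) simp
  moreover have "(cmod w)\<^sup>2 < 1"
    using w by (simp add: power_less_one_iff abs_square_less_1)
  ultimately have "(cmod (a * w + b))\<^sup>2 < (cmod (cnj b * w + cnj a))\<^sup>2"
    by linarith
  then have "cmod (a * w + b) < cmod (cnj b * w + cnj a)"
    by (rule power2_less_imp_less) simp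
  then show ?thesis
    by (simp add: norm_divide divide_less_eq)
qed

section \<open>The action of the Jacobi group on coherent states\<close>

context jacobi_lowest_weight
begin

lemma unitary_group_rep:
  assumes x: "\<And>t. x t \<in> jacobi_group" and add: "\<And>s t. x (s + t) = jacobi_mult (x s) (x t)"
    and cont: "continuous_on UNIV x"
  shows "unitary_group (\<lambda>t. \<pi> (x t))"
proof -
  have "continuous_on UNIV (\<lambda>t. \<pi> (x t) v)" for v
    by (rule continuous_on_compose2 [OF _ cont, where t = jacobi_group and g = "\<lambda>x. \<pi> x v"])
      (use rep x in \<open>auto simp: unitary_rep_def\<close>)
  then show ?thesis
    using rep x add by (simp add: unitary_group_def unitary_rep_def)
qed

lemma su11_act_1 [simp]: "su11_act (mat 1) x = x"
  by (simp add: su11_act_def mat_def)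

lemma unitary_group_heisenberg: "unitary_group (\<lambda>t. \<pi> (of_real t * x, t * s, mat 1))"
proof (rule unitary_group_rep)
  show "(of_real t * x, t * s, mat 1) \<in> jacobi_group" for t
    using SU11_mat2 [of 1 0] by (simp add: jacobi_group_def mat_1_eq_mat2)
  show "(of_real (r + t) * x, (r + t) * s, mat 1) =
      jacobi_mult (of_real r * x, r * s, mat 1) (of_real t * x, t * s, mat 1)" for r t
    by (simp add: theta_h_def algebra_simps)
  show "continuous_on UNIV (\<lambda>t. (of_real t * x, t * s, mat 1 :: complex^2^2))"
    by (intro continuous_intros)
qed

text \<open>Stated for any unitary group with this generator, so that it also settles uniqueness in
  \<open>displacement_eq\<close>. Here w is fixed and z moves linearly, hence the exponent of the
  multiplier is quadratic in time.\<close>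

lemma heisenberg_coherent:
  assumes U: "unitary_group U"
    and gen: "\<And>v. v \<in> V \<Longrightarrow> ((\<lambda>t. U t v) has_vector_derivative
      (\<i> * of_real s) *\<^sub>C v + x *\<^sub>C cre v - cnj x *\<^sub>C ann v) (at 0)"
    and w: "cmod w < 1"
  shows "U 1 (e z w) = exp (\<i> * of_real s - cnj x * z - cnj x * (x - cnj x * w) / 2) *\<^sub>C
    e (z + (x - cnj x * w)) w"
proof -
  define c where "c = cnj x * (x - cnj x * w) / 2"
  let ?z = "\<lambda>t. z + of_real t * (x - cnj x * w)"
  let ?l = "\<lambda>t. exp (of_real t * (\<i> * of_real s - cnj x * z) - (of_real t)\<^sup>2 * c)"
  have "U 1 (e (?z 0) w) = ?l 1 *\<^sub>C e (?z 1) w"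
  proof (rule unitary_group_coherent [OF U, where s = s and x = x and \<theta> = 0 and y = 0 and w = "\<lambda>_. w"])
    show "((\<lambda>t. U t v) has_vector_derivative lie_op s x 0 0 v) (at 0)" if "v \<in> V" for v
      using gen [OF that] by (simp add: lie_op_def)
    show "(?z has_vector_derivative
        x - cnj x * w + \<i> * of_real 0 * ?z t - cnj 0 * ?z t * w) (at t)" for t
      by (rule has_vector_derivative_real_field [where f = "\<lambda>t. z + t * (x - cnj x * w)"])
        (auto intro!: derivative_eq_intros)
    fix t
    have "\<i> * of_real s - cnj x * ?z t + 2 * \<i> * of_real 0 * of_real k -
        cnj 0 * (2 * of_real k * w + (?z t)\<^sup>2 / 2) = \<i> * of_real s - cnj x * z - 2 * of_real t * c"
      by (simp add: c_def field_simps)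
    then show "(?l has_vector_derivative ?l t * (\<i> * of_real s - cnj x * ?z t +
        2 * \<i> * of_real 0 * of_real k - cnj 0 * (2 * of_real k * w + (?z t)\<^sup>2 / 2))) (at t)"
      by (simp only:) (rule has_vector_derivative_real_field
          [where f = "\<lambda>t. exp (t * (\<i> * of_real s - cnj x * z) - t\<^sup>2 * c)"],
        auto intro!: derivative_eq_intros simp: algebra_simps)
  qed (use w in simp_all)
  then show ?thesis
    by (simp add: c_def)
qed

lemma unitary_group_SU11:
  assumes a: "\<And>t. (cmod (a t))\<^sup>2 - (cmod (b t))\<^sup>2 = 1"
    and add: "\<And>s t. a (s + t) = a s * a t + b s * cnj (b t)"
      "\<And>s t. b (s + t) = a s * b t + b s * cnj (a t)"
    and cont: "continuous_on UNIV a" "continuous_on UNIV b"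
  shows "unitary_group (\<lambda>t. \<pi> (0, 0, mat2 (a t) (b t) (cnj (b t)) (cnj (a t))))"
proof (rule unitary_group_rep)
  show "(0, 0, mat2 (a t) (b t) (cnj (b t)) (cnj (a t))) \<in> jacobi_group" for t
    using SU11_mat2 [OF a] by (simp add: jacobi_group_def)
  show "(0, 0, mat2 (a (s + t)) (b (s + t)) (cnj (b (s + t))) (cnj (a (s + t)))) =
      jacobi_mult (0, 0, mat2 (a s) (b s) (cnj (b s)) (cnj (a s)))
        (0, 0, mat2 (a t) (b t) (cnj (b t)) (cnj (a t)))" for s t
    by (simp add: su11_act_def theta_h_def mat2_mult add algebra_simps)
  show "continuous_on UNIV (\<lambda>t. (0 :: complex, 0 :: real, mat2 (a t) (b t) (cnj (b t)) (cnj (a t))))"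
    by (intro continuous_on_Pair continuous_on_const continuous_on_mat2 continuous_on_cnj cont)
qed

text \<open>The generator is 2i \<open>K0\<close>, and \<open>cre\<close> and \<open>Kp\<close> have
  weights 1/2 and 1; hence z turns by the angle t and w by 2t.\<close>

lemma rotation_coherent:
  assumes w: "cmod w < 1"
  shows "\<pi> (0, 0, mat2 (cis t) 0 0 (cis (- t))) (e z w) =
    exp (2 * \<i> * of_real (t * k)) *\<^sub>C e (cis t * z) ((cis t)\<^sup>2 * w)"
proof -
  let ?U = "\<lambda>t. \<pi> (0, 0, mat2 (cis t) 0 0 (cis (- t)))"
  have U: "unitary_group ?U"
    using unitary_group_SU11 [of cis "\<lambda>_. 0"]
    by (simp add: cis_mult cis_cnj continuous_on_cis)
  have "?U t (e (cis 0 * z) ((cis 0)\<^sup>2 * w)) =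
      exp (2 * \<i> * of_real (t * k)) *\<^sub>C e (cis t * z) ((cis t)\<^sup>2 * w)"
  proof (rule unitary_group_coherent [OF U, where s = 0 and x = 0 and \<theta> = 1 and y = 0
        and l = "\<lambda>t. exp (2 * \<i> * of_real (t * k))"])
    show "((\<lambda>t. ?U t v) has_vector_derivative lie_op 0 0 1 0 v) (at 0)" if "v \<in> V" for v
      using derived_su11 [OF that, of 1 0] by (simp add: lie_op_def mat_exp_rotation)
    show "((\<lambda>t. cis t * z) has_vector_derivative 0 - cnj 0 * ((cis t)\<^sup>2 * w) +
        \<i> * of_real 1 * (cis t * z) - cnj 0 * (cis t * z) * ((cis t)\<^sup>2 * w)) (at t)" for t
      unfolding cis_conv_exp
      by (rule has_vector_derivative_real_field [where f = "\<lambda>t. exp (\<i> * t) * z"])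
        (auto intro!: derivative_eq_intros)
    show "((\<lambda>t. (cis t)\<^sup>2 * w) has_vector_derivative 2 * \<i> * of_real 1 * ((cis t)\<^sup>2 * w) + 0 -
        cnj 0 * ((cis t)\<^sup>2 * w)\<^sup>2) (at t)" for t
      unfolding cis_conv_exp
      by (rule has_vector_derivative_real_field [where f = "\<lambda>t. (exp (\<i> * t))\<^sup>2 * w"])
        (auto intro!: derivative_eq_intros simp: power2_eq_square)
    show "((\<lambda>t. exp (2 * \<i> * of_real (t * k))) has_vector_derivative exp (2 * \<i> * of_real (t * k)) *
        (\<i> * of_real 0 - cnj 0 * (cis t * z) + 2 * \<i> * of_real 1 * of_real k -
          cnj 0 * (2 * of_real k * ((cis t)\<^sup>2 * w) + (cis t * z)\<^sup>2 / 2))) (at t)" for t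
      unfolding of_real_mult
      by (rule has_vector_derivative_real_field [where f = "\<lambda>t. exp (2 * \<i> * (t * of_real k))"])
        (auto intro!: derivative_eq_intros)
  qed (use w in \<open>simp_all add: norm_mult norm_power\<close>)
  then show ?thesis
    by simp
qed

end

lemma complex_of_real_cosh: "complex_of_real (cosh t) = cosh (of_real t)"
  and complex_of_real_sinh: "complex_of_real (sinh t) = sinh (of_real t)"
  by (simp_all add: cosh_field_def sinh_field_def flip: exp_of_real of_real_minus)

context jacobi_lowest_weight
begin

text \<open>The Riccati equation for w is linearised by w = y D / C with C' = D and D' = C, where C
  is the fractional linear denominator. Then z / C solves the equation for z, the weight k part of
  the multiplier integrates to C^(-2k), and the z^2 part integrates through (sinh / C)' = 1 /
  C^2.\<close>

lemma hyperbolic_coherent: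
  fixes n :: nat and t :: real
  assumes y: "cmod y = 1" and w: "cmod w < 1" and n: "2 * k = real n"
  defines "c \<equiv> of_real (cosh t) + cnj y * of_real (sinh t) * w"
  shows "\<pi> (0, 0, boost y t) (e z w) =
    (exp (- cnj y * of_real (sinh t) * z\<^sup>2 / (2 * c)) * inverse c ^ n) *\<^sub>C
      e (z / c) ((of_real (cosh t) * w + y * of_real (sinh t)) / c)"
proof -
  have yy: "y * cnj y = 1"
    using complex_norm_square [of y] y by simp
  have k: "2 * complex_of_real k = of_nat n"
    using arg_cong [OF n, of complex_of_real] by simp
  obtain m where m: "n = Suc m"
    using n k_pos by (cases n) auto
  define C where "C s = cosh s + cnj y * sinh s * w" for s
  define D where "D s = sinh s + cnj y * cosh s * w" for s
  define E where "E s = - cnj y * z\<^sup>2 / 2 * (sinh s / C s)" for s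
  let ?U = "\<lambda>t. \<pi> (0, 0, boost y t)"
  let ?z = "\<lambda>t::real. z / C t" and ?w = "\<lambda>t::real. y * D t / C t"
  let ?l = "\<lambda>t::real. exp (E t) * inverse (C t) ^ n"
  have hyp: "(cmod (of_real (cosh t)))\<^sup>2 - (cmod (y * of_real (sinh t)))\<^sup>2 = 1" for t :: real
    by (simp add: norm_mult y cosh_square_eq)
  have yD: "y * D t = of_real (cosh t) * w + y * of_real (sinh t)" for t :: real
    using yy by (simp add: D_def complex_of_real_cosh complex_of_real_sinh algebra_simps)
  have Ct: "C t = of_real (cosh t) + cnj y * of_real (sinh t) * w" for t :: real
    by (simp add: C_def complex_of_real_cosh complex_of_real_sinh)
  have C0: "C t \<noteq> 0" for t :: real
    using denominator_SU11 [OF hyp w, of t] by (simp add: Ct algebra_simps)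
  have U: "unitary_group ?U"
    using unitary_group_SU11 [of "\<lambda>t. of_real (cosh t)" "\<lambda>t. y * of_real (sinh t)"] hyp yy
    by (simp add: cosh_add sinh_add algebra_simps continuous_intros)
  have DC: "(C has_field_derivative D s) (at s)" and DD: "(D has_field_derivative C s) (at s)" for s
    unfolding C_def D_def by (auto intro!: derivative_eq_intros)
  have "?U t (e (?z 0) (?w 0)) = ?l t *\<^sub>C e (?z t) (?w t)"
  proof (rule unitary_group_coherent [OF U, where s = 0 and x = 0 and \<theta> = 0 and y = y])
    show "((\<lambda>t. ?U t v) has_vector_derivative lie_op 0 0 0 y v) (at 0)" if "v \<in> V" for v
      using derived_su11 [OF that, of 0 y] by (simp add: lie_op_def mat_exp_hyperbolic y)
    fix t :: real
    have yy': "cnj y * (y * v) = v" for v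
    proof -
      have "cnj y * (y * v) = (y * cnj y) * v"
        by (simp only: mult_ac)
      then show ?thesis
        by (simp add: yy)
    qed
    have "((\<lambda>s. z / C s) has_field_derivative - (z * D t) / (C t * C t)) (at (of_real t))"
      by (rule DERIV_cong [OF DERIV_divide [OF DERIV_const DC C0]]) simp
    note has_vector_derivative_real_field [OF this]
    moreover have "0 - cnj 0 * ?w t + \<i> * of_real 0 * ?z t - cnj y * ?z t * ?w t =
        - (z * D t) / (C t * C t)"
      by (simp add: mult.left_commute [of _ y] yy' yy)
    ultimately show "(?z has_vector_derivative
        0 - cnj 0 * ?w t + \<i> * of_real 0 * ?z t - cnj y * ?z t * ?w t) (at t)"
      by (simp only:)
    have "((\<lambda>s. y * D s / C s) has_field_derivative (y * C t * C t - y * D t * D t) / (C t * C t))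
        (at (of_real t))"
      by (rule DERIV_divide [OF DERIV_cmult [OF DD] DC C0])
    note has_vector_derivative_real_field [OF this]
    moreover have "2 * \<i> * of_real 0 * ?w t + y - cnj y * (?w t)\<^sup>2 =
        (y * C t * C t - y * D t * D t) / (C t * C t)"
      using C0 [of t] by (simp add: power2_eq_square yy yy' diff_divide_distrib mult_ac)
    ultimately show "(?w has_vector_derivative
        2 * \<i> * of_real 0 * ?w t + y - cnj y * (?w t)\<^sup>2) (at t)"
      by (simp only:)
    have "(sinh has_field_derivative cosh s) (at s)" for s :: complex
      by (auto intro!: derivative_eq_intros)
    then have "(E has_field_derivative - cnj y * z\<^sup>2 / 2 *
        ((cosh (of_real t) * C t - sinh (of_real t) * D t) / (C t * C t))) (at (of_real t))"
      unfolding E_def [abs_def] by (intro DERIV_cmult DERIV_divide DC C0)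
    moreover have "cosh (of_real t) * C t - sinh (of_real t) * D t = 1"
      using cosh_square_eq [of "complex_of_real t"]
      by (simp add: C_def D_def power2_eq_square algebra_simps)
    ultimately have DE: "(E has_field_derivative - cnj y * z\<^sup>2 / (2 * (C t * C t))) (at (of_real t))"
      by simp
    have "((\<lambda>s. exp (E s) * inverse (C s) ^ Suc m) has_field_derivative
        exp (E t) * (- cnj y * z\<^sup>2 / (2 * (C t * C t))) * inverse (C t) ^ Suc m +
        of_nat (Suc m) * (- (inverse (C t) * D t * inverse (C t)) * inverse (C t) ^ m) * exp (E t))
        (at (of_real t))"
      by (rule DERIV_cong [OF DERIV_mult [OF DERIV_chain2 [OF DERIV_exp DE]
              DERIV_power [OF DERIV_inverse' [OF DC C0]]]])
        (simp del: of_nat_Suc)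
    note has_vector_derivative_real_field [OF this]
    moreover have "?l t * (\<i> * of_real 0 - cnj 0 * ?z t +
        2 * \<i> * of_real 0 * of_real k - cnj y * (2 * of_real k * ?w t + (?z t)\<^sup>2 / 2)) =
        exp (E t) * (- cnj y * z\<^sup>2 / (2 * (C t * C t))) * inverse (C t) ^ Suc m +
        of_nat (Suc m) * (- (inverse (C t) * D t * inverse (C t)) * inverse (C t) ^ m) * exp (E t)"
    proof -
      have "cnj y * (2 * of_real k * ?w t + (?z t)\<^sup>2 / 2) =
          of_nat n * (D t * inverse (C t)) + cnj y * z\<^sup>2 / (2 * (C t * C t))"
      proof -
        have *: "q * (N * (y * d / c) + (z / c)\<^sup>2 / 2) = (y * q) * (N * (d * inverse c)) + q * z\<^sup>2 / (2 * (c * c))"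
          for q N d c y z :: complex
          by (cases "c = 0") (simp_all add: field_simps power2_eq_square)
        show ?thesis
          unfolding k * yy by simp
      qed
      then show ?thesis
        unfolding m by (simp add: algebra_simps del: of_nat_Suc)
    qed
    ultimately show "(?l has_vector_derivative ?l t * (\<i> * of_real 0 - cnj 0 * ?z t +
        2 * \<i> * of_real 0 * of_real k - cnj y * (2 * of_real k * ?w t + (?z t)\<^sup>2 / 2))) (at t)"
      unfolding m by (simp only:)
    show "cmod (?w t) < 1"
      using norm_SU11_act_less [OF hyp w, of t]
      by (simp add: yD Ct algebra_simps)
    show "?l 0 = 1"
      by (simp add: E_def C_def)
  qed
  then show ?thesis
    using yD [of 0] yD [of t]
    by (simp add: C_def E_def c_def complex_of_real_cosh complex_of_real_sinh mult_ac)
qed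

text \<open>Polar decomposition: g is a boost times diag(u, cnj u), where u is the phase of a. The
  rotation contributes the phase u^n, which cancels because the denominator of the boost is u times
  c.\<close>

lemma SU11_coherent:
  fixes n :: nat
  assumes ab: "(cmod a)\<^sup>2 - (cmod b)\<^sup>2 = 1" and w: "cmod w < 1" and n: "2 * k = real n"
  defines "c \<equiv> cnj b * w + cnj a"
  shows "\<pi> (0, 0, mat2 a b (cnj b) (cnj a)) (e z w) =
    (exp (- cnj b * z\<^sup>2 / (2 * c)) * inverse c ^ n) *\<^sub>C e (z / c) ((a * w + b) / c)"
proof -
  define t where "t = arsinh (cmod b)"
  define u where "u = cis (Arg a)"
  \<comment> \<open>Chosen so that y sinh t times the conjugate of u is b. For b = 0 the boost is
    the identity and any unit y serves.\<close>
  define y where "y = (if b = 0 then 1 else u * b / cmod b)"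
  have sinh: "sinh t = cmod b"
    by (simp add: t_def)
  have "(cosh t)\<^sup>2 = (cmod a)\<^sup>2"
    using ab by (simp add: cosh_square_eq sinh)
  then have cosh: "cosh t = cmod a"
    by (simp add: power2_eq_iff_nonneg)
  have u: "cmod u = 1" "u * cnj u = 1" "cnj u = cis (- Arg a)"
    by (simp_all add: u_def cis_cnj cis_mult)
  have a: "a = of_real (cosh t) * u"
    using rcis_cmod_Arg [of a] by (simp add: cosh u_def rcis_def)
  have y: "cmod y = 1"
    by (simp add: y_def norm_mult norm_divide u)
  have b: "b = y * of_real (sinh t) * cnj u"
    using u(2) by (simp add: y_def sinh mult_ac)
  define c' where "c' = of_real (cosh t) + cnj y * of_real (sinh t) * (u\<^sup>2 * w)"
  have c': "c' = u * c"
    using u(2) unfolding c'_def c_def a b by (simp add: algebra_simps power2_eq_square)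
  have c0: "c \<noteq> 0" "u \<noteq> 0"
    using denominator_SU11 [OF ab w] u by (auto simp: c_def)
  have w': "cmod (u\<^sup>2 * w) < 1"
    using w by (simp add: norm_mult norm_power u)
  have mat: "(0, 0, mat2 a b (cnj b) (cnj a)) =
      jacobi_mult (0, 0, boost y t) (0, 0, mat2 u 0 0 (cnj u))"
    unfolding a b by (simp add: su11_act_def theta_h_def mat2_mult mult_ac)
  have hyp: "(cmod (of_real (cosh t)))\<^sup>2 - (cmod (y * of_real (sinh t)))\<^sup>2 = 1"
    by (simp add: norm_mult y cosh_square_eq)
  have in_group: "(0, 0, boost y t) \<in> jacobi_group"
    "(0, 0, mat2 u 0 0 (cnj u)) \<in> jacobi_group"
    using SU11_mat2 [OF hyp] SU11_mat2 [of u 0] by (simp_all add: jacobi_group_def u)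
  have "of_nat n = 2 * complex_of_real k"
    using arg_cong [OF n, of complex_of_real] by simp
  then have k: "exp (2 * \<i> * of_real (Arg a * k)) = u ^ n"
    by (simp add: u_def cis_conv_exp mult_ac exp_of_nat_mult [symmetric])
  have "\<pi> (0, 0, mat2 a b (cnj b) (cnj a)) (e z w) =
      \<pi> (0, 0, boost y t) (\<pi> (0, 0, mat2 u 0 0 (cnj u)) (e z w))"
    using rep in_group unfolding mat unitary_rep_def by (metis comp_apply)
  also have "\<pi> (0, 0, mat2 u 0 0 (cnj u)) (e z w) = u ^ n *\<^sub>C e (u * z) (u\<^sup>2 * w)"
    using rotation_coherent [OF w, of "Arg a" z] unfolding k u(3) unfolding u_def .
  also have "\<pi> (0, 0, boost y t) \<dots> =
      u ^ n *\<^sub>C (exp (- cnj y * of_real (sinh t) * (u * z)\<^sup>2 / (2 * c')) * inverse c' ^ n) *\<^sub>C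
      e (u * z / c') ((of_real (cosh t) * (u\<^sup>2 * w) + y * of_real (sinh t)) / c')"
    using rep in_group(1) hyperbolic_coherent [OF y w' n, of t "u * z"]
    by (simp add: unitary_rep_def unitary_op_scaleC c'_def)
  also have "- cnj y * of_real (sinh t) * (u * z)\<^sup>2 / (2 * c') = - cnj b * z\<^sup>2 / (2 * c)"
    using c0 u(2) by (simp add: c' b field_simps power2_eq_square)
  also have "u * z / c' = z / c"
    using c0 by (simp add: c')
  also have "(of_real (cosh t) * (u\<^sup>2 * w) + y * of_real (sinh t)) / c' = (a * w + b) / c"
  proof -
    have "u * (a * w + b) = of_real (cosh t) * (u\<^sup>2 * w) + y * of_real (sinh t)"
      using u(2) unfolding a b by (simp add: algebra_simps power2_eq_square)
    from this [symmetric] show ?thesis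
      using c0 by (simp add: c')
  qed
  also have "u ^ n *\<^sub>C (exp (- cnj b * z\<^sup>2 / (2 * c)) * inverse c' ^ n) *\<^sub>C e (z / c) ((a * w + b) / c) =
      (exp (- cnj b * z\<^sup>2 / (2 * c)) * inverse c ^ n) *\<^sub>C e (z / c) ((a * w + b) / c)"
    using c0 by (simp add: scaleC_scaleC c' power_mult_distrib field_simps)
  finally show ?thesis .
qed

section \<open>Totality of the coherent states and the displacement operator\<close>

lemma orbit_coherent:
  assumes "x \<in> jacobi_group"
  obtains c z w where "cmod w < 1" "\<pi> x e0 = c *\<^sub>C e z w"
proof -
  obtain \<alpha> s a b where x: "x = (\<alpha>, s, mat2 a b (cnj b) (cnj a))" and ab: "(cmod a)\<^sup>2 - (cmod b)\<^sup>2 = 1"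
    using assms by (auto simp: jacobi_group_def SU11_def)
  obtain n :: nat where n: "2 * k = real n"
    using k_half_int by auto
  \<comment> \<open>The Heisenberg factor stands on the left, so \<open>SU11\<close> acts first, on
    e0 = \<open>e 0 0\<close>.\<close>
  have mult: "x = jacobi_mult (\<alpha>, s, mat 1) (0, 0, mat2 a b (cnj b) (cnj a))"
    by (simp add: x theta_h_def)
  have in_group: "(\<alpha>, s, mat 1) \<in> jacobi_group" "(0, 0, mat2 a b (cnj b) (cnj a)) \<in> jacobi_group"
    using SU11_mat2 [OF ab] SU11_mat2 [of 1 0] by (simp_all add: jacobi_group_def mat_1_eq_mat2)
  obtain c w where w: "cmod w < 1" and c: "\<pi> (0, 0, mat2 a b (cnj b) (cnj a)) e0 = c *\<^sub>C e 0 w"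
    using SU11_coherent [OF ab _ n, of 0 0] norm_SU11_act_less [OF ab, of 0] by (simp add: e_zero)
  obtain d z where "\<pi> (\<alpha>, s, mat 1) (e 0 w) = d *\<^sub>C e z w"
    using heisenberg_coherent [OF unitary_group_heisenberg [of \<alpha> s] derived_heis w] by auto
  moreover have "\<pi> x e0 = \<pi> (\<alpha>, s, mat 1) (\<pi> (0, 0, mat2 a b (cnj b) (cnj a)) e0)"
    using rep in_group unfolding mult unitary_rep_def by (metis comp_apply)
  moreover have "unitary_op (\<pi> (\<alpha>, s, mat 1))"
    using rep in_group by (simp add: unitary_rep_def)
  ultimately have "\<pi> x e0 = (c * d) *\<^sub>C e z w"
    by (simp add: c unitary_op_scaleC scaleC_scaleC)
  with w show ?thesis
    by (rule that)
qed

lemma unitary_op_eqI: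
  assumes T: "unitary_op T" and T': "unitary_op T'"
    and eq: "\<And>z w. cmod w < 1 \<Longrightarrow> T (e z w) = T' (e z w)"
  shows "T = T'"
proof
  fix v
  note lin = unitary_op_bounded_linear [OF T] unitary_op_bounded_linear [OF T']
  have "T v = T' v" if "v \<in> span {c *\<^sub>C \<pi> x e0 |c x. x \<in> jacobi_group}" for v
  proof (rule linear_eq_on_span [OF _ _ _ that])
    fix v assume "v \<in> {c *\<^sub>C \<pi> x e0 |c x. x \<in> jacobi_group}"
    then obtain c x where v: "v = c *\<^sub>C \<pi> x e0" and "x \<in> jacobi_group"
      by blast
    from this(2) obtain d z w where "cmod w < 1" "\<pi> x e0 = d *\<^sub>C e z w"
      by (rule orbit_coherent)
    then show "T v = T' v"
      by (simp add: v eq unitary_op_scaleC T T')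
  qed (use lin in \<open>simp_all add: bounded_linear.linear\<close>)
  moreover have "closed {v. T v = T' v}"
    by (intro closed_Collect_eq linear_continuous_on lin)
  ultimately have "closure (span {c *\<^sub>C \<pi> x e0 |c x. x \<in> jacobi_group}) \<subseteq> {v. T v = T' v}"
    by (intro closure_minimal) auto
  then show "T v = T' v"
    unfolding cyclic by auto
qed

text \<open>\<open>op_exp\<close> is a definite description, so uniqueness must be proved: for any
  competing group, \<open>heisenberg_coherent\<close> computes its value on coherent states from the
  generator alone.\<close>

lemma displacement_eq: "displacement V ann cre \<alpha> = \<pi> (\<alpha>, 0, mat 1)"
  unfolding displacement_def op_exp_def
proof (rule the_equality)
  let ?U = "\<lambda>t. \<pi> (of_real t * \<alpha>, t * 0, mat 1)"
  have U: "unitary_group ?U"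
    by (rule unitary_group_heisenberg)
  have gen: "((\<lambda>t. ?U t v) has_vector_derivative \<alpha> *\<^sub>C cre v - cnj \<alpha> *\<^sub>C ann v) (at 0)" if "v \<in> V" for v
    using derived_heis [OF that, of \<alpha> 0] by simp
  have U1: "?U 1 = \<pi> (\<alpha>, 0, mat 1)"
    by simp
  show "\<exists>U. unitary_group U \<and> (\<forall>v\<in>V. ((\<lambda>t. U t v) has_vector_derivative
      \<alpha> *\<^sub>C cre v - cnj \<alpha> *\<^sub>C ann v) (at 0)) \<and> \<pi> (\<alpha>, 0, mat 1) = U 1"
    using U gen U1 by (intro exI [of _ ?U]) simp
  fix T
  assume "\<exists>U. unitary_group U \<and> (\<forall>v\<in>V. ((\<lambda>t. U t v) has_vector_derivative
      \<alpha> *\<^sub>C cre v - cnj \<alpha> *\<^sub>C ann v) (at 0)) \<and> T = U 1"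
  then obtain U' where U': "unitary_group U'" and T: "T = U' 1"
    and gen': "\<And>v. v \<in> V \<Longrightarrow> ((\<lambda>t. U' t v) has_vector_derivative \<alpha> *\<^sub>C cre v - cnj \<alpha> *\<^sub>C ann v) (at 0)"
    by blast
  have "U' 1 = ?U 1"
  proof (rule unitary_op_eqI)
    fix z w assume w: "cmod w < 1"
    show "U' 1 (e z w) = ?U 1 (e z w)"
      using heisenberg_coherent [OF U _ w, where s = 0 and x = \<alpha> and z = z]
        heisenberg_coherent [OF U' _ w, where s = 0 and x = \<alpha> and z = z] gen gen' by simp
  qed (rule unitary_group_op [OF U'], rule unitary_group_op [OF U])
  then show "T = \<pi> (\<alpha>, 0, mat 1)"
    by (simp only: T U1)
qed

lemma displacement_coherent:
  assumes "cmod w < 1"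
  shows "displacement V ann cre \<alpha> (e z w) =
    exp (- cnj \<alpha> * z - cnj \<alpha> * (\<alpha> - cnj \<alpha> * w) / 2) *\<^sub>C e (\<alpha> - cnj \<alpha> * w + z) w"
  using heisenberg_coherent [OF unitary_group_heisenberg [of \<alpha> 0] derived_heis assms, of z]
  by (simp add: displacement_eq add.commute)

end

text \<open>Here p is \<alpha>0. By \<open>displacement_coherent\<close>, D(p) sends
  \<open>e 0 w\<close> to a multiple of \<open>e (p - cnj p * w) w\<close>, so \<alpha>0 is the
  displacement that produces z.\<close>

lemma conjugate_symbol:
  assumes "cmod w < 1" and p: "p = (z + cnj z * w) / (1 - w * cnj w)"
  shows "z = p - cnj p * w"
proof -
  have "(cmod w)\<^sup>2 < 1"
    using assms(1) by (simp add: abs_square_less_1)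
  then have "1 - w * cnj w \<noteq> 0"
    unfolding complex_norm_square [symmetric] by (metis eq_iff_diff_eq_0 less_irrefl of_real_eq_1_iff)
  moreover have "cnj p = (cnj z + z * cnj w) / (1 - w * cnj w)"
    by (simp add: p mult.commute)
  then have "p - cnj p * w = ((z + cnj z * w) - (cnj z + z * cnj w) * w) / (1 - w * cnj w)"
    by (simp add: p diff_divide_distrib)
  moreover have "(z + cnj z * w) - (cnj z + z * cnj w) * w = z * (1 - w * cnj w)"
    by (simp add: algebra_simps)
  ultimately show ?thesis
    by simp
qed

theorem proposition1:
  fixes \<pi> :: "jacobi \<Rightarrow> 'h::{complex_inner, polish_space} \<Rightarrow> 'h"
    and ann cre K0 Kp Km :: "'h \<Rightarrow> 'h" and e0 :: 'h and k :: real
    and a b \<alpha> z w :: complex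
  assumes "jacobi_lowest_weight \<pi> ann cre K0 Kp Km e0 k"
    and "(cmod a)\<^sup>2 - (cmod b)\<^sup>2 = 1"
    and "cmod w < 1"
  shows
    "let S = SU11_rep \<pi>;
         D = displacement (smooth_vectors \<pi>) ann cre;
         e = coherent cre Kp e0;
         g = mat2 a b (cnj b) (cnj a);
         z1 = (\<alpha> - cnj \<alpha> * w + z) / (cnj b * w + cnj a);
         w1 = (a * w + b) / (cnj b * w + cnj a);
         \<alpha>0 = (z + cnj z * w) / (1 - w * cnj w);
         \<alpha>1 = \<alpha> + \<alpha>0;
         \<alpha>2 = (\<alpha> + \<alpha>0) * a + (cnj \<alpha> + cnj \<alpha>0) * b;
         lam = (cnj a + cnj b * w) powr (- 2 * complex_of_real k)
               * exp (z / 2 * cnj \<alpha>0 - z1 / 2 * cnj \<alpha>2)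
               * exp (\<i> * complex_of_real (theta_h \<alpha>1 \<alpha>0))
     in S g (D \<alpha> (e z w)) = lam *\<^sub>C e z1 w1"
proof -
  interpret jacobi_lowest_weight \<pi> ann cre K0 Kp Km e0 k
    by (rule assms(1))
  obtain n :: nat where n: "2 * k = real n"
    using k_half_int by auto
  define c where "c = cnj b * w + cnj a"
  define z1 where "z1 = (\<alpha> - cnj \<alpha> * w + z) / c"
  define p where "p = (z + cnj z * w) / (1 - w * cnj w)"
  have c: "c \<noteq> 0"
    unfolding c_def by (rule denominator_SU11 [OF assms(2,3)])
  have z: "z = p - cnj p * w"
    by (rule conjugate_symbol [OF assms(3) p_def])
  \<comment> \<open>The product of p with its conjugate is real, so only the cross term of \<alpha>
    and p contributes.\<close>
  have theta: "\<i> * complex_of_real (theta_h (\<alpha> + p) p) = (\<alpha> * cnj p - cnj \<alpha> * p) / 2"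
  proof -
    have "\<i> * complex_of_real (Im q) = (q - cnj q) / 2" for q
      by (simp add: complex_eq_iff)
    then show ?thesis
      by (simp add: theta_h_def complex_eq_iff algebra_simps)
  qed
  have "z1 * c = \<alpha> - cnj \<alpha> * w + z"
    using c by (simp add: z1_def)
  also have "\<dots> = (\<alpha> + p) - (cnj \<alpha> + cnj p) * w"
    by (subst z) (simp add: algebra_simps)
  finally have z1c: "z1 * c = (\<alpha> + p) - (cnj \<alpha> + cnj p) * w" .
  \<comment> \<open>With \<beta> = \<alpha> + p, the conjugate of \<alpha>2 is c times the conjugate
    of \<beta> plus cnj b times (\<beta> - cnj \<beta> w), and the last bracket is
    \<open>z1 * c\<close>. This produces the \<open>z1\<^sup>2\<close> term of the exponent coming
    from \<open>SU11_coherent\<close>.\<close>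
  have "z1 * cnj ((\<alpha> + p) * a + (cnj \<alpha> + cnj p) * b) =
      z1 * c * (cnj \<alpha> + cnj p) + cnj b * z1 * ((\<alpha> + p) - (cnj \<alpha> + cnj p) * w)"
    by (simp add: c_def algebra_simps)
  also have "\<dots> = ((\<alpha> + p) - (cnj \<alpha> + cnj p) * w) * (cnj \<alpha> + cnj p) + cnj b * z1\<^sup>2 * c"
    unfolding z1c [symmetric] by (simp add: power2_eq_square mult_ac)
  finally have \<alpha>2: "z1 * cnj ((\<alpha> + p) * a + (cnj \<alpha> + cnj p) * b) =
      ((\<alpha> + p) - (cnj \<alpha> + cnj p) * w) * (cnj \<alpha> + cnj p) + cnj b * z1\<^sup>2 * c" .
  have b: "- cnj b * (\<alpha> - cnj \<alpha> * w + z)\<^sup>2 / (2 * c) = - (cnj b * z1\<^sup>2 * c) / 2"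
    using c by (simp add: z1_def power2_eq_square field_simps)
  have exponent: "(- cnj \<alpha> * z - cnj \<alpha> * (\<alpha> - cnj \<alpha> * w) / 2) +
      - cnj b * (\<alpha> - cnj \<alpha> * w + z)\<^sup>2 / (2 * c) =
    (z / 2 * cnj p - z1 / 2 * cnj ((\<alpha> + p) * a + (cnj \<alpha> + cnj p) * b)) +
      \<i> * complex_of_real (theta_h (\<alpha> + p) p)"
    (is "?L = ?R")
  proof -
    have "2 * ?L = - 2 * cnj \<alpha> * z - cnj \<alpha> * (\<alpha> - cnj \<alpha> * w) - cnj b * z1\<^sup>2 * c"
      unfolding b by (simp add: field_simps)
    also have "\<dots> = z * cnj p - z1 * cnj ((\<alpha> + p) * a + (cnj \<alpha> + cnj p) * b) + (\<alpha> * cnj p - cnj \<alpha> * p)"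
      unfolding \<alpha>2 by (subst (1 2) z) (simp add: algebra_simps)
    also have "\<dots> = 2 * ?R"
      unfolding theta by (simp add: field_simps)
    finally show ?thesis
      by (rule iffD1 [OF mult_left_cancel, rotated]) simp
  qed
  \<comment> \<open>Since 2k is a natural number, the principal power is an ordinary power of the
    nonzero denominator.\<close>
  have powr: "(cnj a + cnj b * w) powr (- 2 * complex_of_real k) = inverse c ^ n"
  proof -
    have "complex_of_real (2 * k) = of_nat n"
      unfolding n by simp
    then show ?thesis
      using c by (simp add: powr_minus powr_nat' power_inverse c_def add.commute)
  qed
  have "\<pi> (0, 0, mat2 a b (cnj b) (cnj a)) (displacement V ann cre \<alpha> (e z w)) =
      exp (- cnj \<alpha> * z - cnj \<alpha> * (\<alpha> - cnj \<alpha> * w) / 2) *\<^sub>C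
      (exp (- cnj b * (\<alpha> - cnj \<alpha> * w + z)\<^sup>2 / (2 * c)) * inverse c ^ n) *\<^sub>C e z1 ((a * w + b) / c)"
    using rep SU11_mat2 [OF assms(2)] SU11_coherent [OF assms(2,3) n, of "\<alpha> - cnj \<alpha> * w + z"]
    by (simp add: displacement_coherent assms(3) unitary_rep_def jacobi_group_def unitary_op_scaleC
        c_def z1_def)
  also have "\<dots> = (inverse c ^ n * exp ?L) *\<^sub>C e z1 ((a * w + b) / c)"
    by (simp only: scaleC_scaleC exp_add mult_ac)
  finally show ?thesis
    unfolding exponent exp_add powr [symmetric]
    unfolding Let_def SU11_rep_def p_def z1_def c_def mult.assoc .
qed

end
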